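(* Let $\mathbb{F}$ be a field, let $V$ be a vector space over $\mathbb{F}$ with countable dimension, and let $u$ be a locally finite endomorphism of $V$. The following conditions are equivalent: (i) $u$ is the sum of two square-zero endomorphisms of $V$; (ii) $u$ has the exchange property. If in addition the characteristic of $\mathbb{F}$ is not $2$, then these conditions are equivalent to: (iii) $u$ is similar to $-u$.
   Context: "Countable" includes finite. An endomorphism $u$ of $V$ is locally finite if for every $x\in V$ the sequence $(u^k(x))_{k\ge 0}$ is linearly dependent over $\mathbb{F}$. An endomorphism $a$ is square-zero if $a^2=0$. An endomorphism $u$ of $V$ has the exchange property when there is a splitting $V=V_1\oplus V_2$ into linear subspaces with $u(V_1)\subset V_2$ and $u(V_2)\subset V_1$. Endomorphisms $u$ of $V$ and $v$ of $W$ are similar if $v=\varphi\circ u\circ\varphi^{-1}$ for some vector space isomorphism $\varphi:V\to W$. *)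

theory Defs
  imports Complex_Main "HOL-Library.Countable_Set"
begin

text \<open>
  A vector space is an instance of the library locale \<open>vector_space\<close>, i.e. a type of vectors with
  a scalar multiplication \<open>scale\<close>. \<open>Vector_Spaces.linear\<close> is qualified because \<open>linear\<close>
  alone denotes linearity over the reals.
\<close>

abbreviation endomorphism ::
    "('a::field \<Rightarrow> 'v::ab_group_add \<Rightarrow> 'v) \<Rightarrow> ('v \<Rightarrow> 'v) \<Rightarrow> bool" where
  "endomorphism scale \<equiv> Vector_Spaces.linear scale scale"

definition countable_dimension ::
    "('a::field \<Rightarrow> 'v::ab_group_add \<Rightarrow> 'v) \<Rightarrow> bool" where
  "countable_dimension scale \<longleftrightarrow>
     (\<exists>B. \<not> module.dependent scale B \<and> module.span scale B = UNIV \<and> countable B)"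

text \<open>
  Linear dependence of a family, as opposed to \<open>module.dependent\<close>, which is about a set: a family
  with a repeated member is dependent, even when its range is an independent set.
\<close>

definition dependent_family ::
    "('a::field \<Rightarrow> 'v::ab_group_add \<Rightarrow> 'v) \<Rightarrow> ('i \<Rightarrow> 'v) \<Rightarrow> bool" where
  "dependent_family scale x \<longleftrightarrow>
     (\<exists>I c. finite I \<and> (\<Sum>k\<in>I. scale (c k) (x k)) = 0 \<and> (\<exists>k\<in>I. c k \<noteq> 0))"

definition locally_finite_endo ::
    "('a::field \<Rightarrow> 'v::ab_group_add \<Rightarrow> 'v) \<Rightarrow> ('v \<Rightarrow> 'v) \<Rightarrow> bool" where
  "locally_finite_endo scale u \<longleftrightarrow>
     endomorphism scale u \<and> (\<forall>x. dependent_family scale (\<lambda>k::nat. (u ^^ k) x))"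

definition square_zero ::
    "('a::field \<Rightarrow> 'v::ab_group_add \<Rightarrow> 'v) \<Rightarrow> ('v \<Rightarrow> 'v) \<Rightarrow> bool" where
  "square_zero scale a \<longleftrightarrow> endomorphism scale a \<and> a \<circ> a = (\<lambda>x. 0)"

definition splitting ::
    "('a::field \<Rightarrow> 'v::ab_group_add \<Rightarrow> 'v) \<Rightarrow> 'v set \<Rightarrow> 'v set \<Rightarrow> bool" where
  "splitting scale V1 V2 \<longleftrightarrow>
     module.subspace scale V1 \<and> module.subspace scale V2 \<and>
     {x + y | x y. x \<in> V1 \<and> y \<in> V2} = UNIV \<and> V1 \<inter> V2 = {0}"

definition exchange_property ::
    "('a::field \<Rightarrow> 'v::ab_group_add \<Rightarrow> 'v) \<Rightarrow> ('v \<Rightarrow> 'v) \<Rightarrow> bool" where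
  "exchange_property scale u \<longleftrightarrow>
     (\<exists>V1 V2. splitting scale V1 V2 \<and> u ` V1 \<subseteq> V2 \<and> u ` V2 \<subseteq> V1)"

definition similar_endo ::
    "('a::field \<Rightarrow> 'v::ab_group_add \<Rightarrow> 'v) \<Rightarrow> ('a \<Rightarrow> 'w::ab_group_add \<Rightarrow> 'w) \<Rightarrow>
     ('v \<Rightarrow> 'v) \<Rightarrow> ('w \<Rightarrow> 'w) \<Rightarrow> bool" where
  "similar_endo scaleV scaleW u v \<longleftrightarrow>
     (\<exists>\<phi>. Vector_Spaces.linear scaleV scaleW \<phi> \<and> bij \<phi> \<and> v = \<phi> \<circ> u \<circ> inv \<phi>)"

end

theory Submission
  imports Defs "HOL-Computational_Algebra.Polynomial"
begin

text \<open>
  View \<open>V\<close> as a torsion \<open>F[t]\<close>-module with \<open>t\<close> acting as \<open>u\<close>. The exchange property says that this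
  module can be graded by the integers modulo 2, where \<open>F[t]\<close> is graded by parity of exponents.

  The heart of the matter is that a countably generated \<open>p\<close>-primary module \<open>W\<close> can always be graded
  when \<open>p\<close> is irreducible and homogeneous. As in Kaplansky and Mackey's proof of Ulm's theorem, \<open>W\<close> is
  exhausted by an increasing sequence of small graded submodules, each of them compatible with the
  transfinite heights of \<open>W\<close>, so that the components of an element have at least its height.

  If \<open>u = a + b\<close> with \<open>a\<^sup>2 = b\<^sup>2 = 0\<close>, this settles the \<open>t\<close>-primary part of \<open>V\<close>, and on the complementary
  part, where \<open>u\<close> is bijective, the kernels of \<open>a\<close> and \<open>b\<close> are exchanged by \<open>u\<close>. If \<open>\<phi> u = - u \<phi>\<close>, then
  \<open>V\<close> is the direct sum of parts of two kinds: the \<open>p\<close>-primary ones with \<open>p\<close> irreducible and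
  homogeneous, and sums of an \<open>r(t)\<close>-primary and an \<open>r(-t)\<close>-primary part that are interchanged by \<open>\<phi>\<close>
  and graded by the vectors \<open>x + \<phi> x\<close> and \<open>x - \<phi> x\<close>.
\<close>

section \<open>Modules over a graded ring\<close>

text \<open>A countably generated primary module with vectors of infinite height need not be a
  direct sum of cyclic modules, so a grading cannot be read off cyclic summands; it is built vector
  by vector. A new vector \<open>x\<close> may be given any degree, provided that \<open>p x\<close>
  is already homogeneous of the matching degree and no vector of the coset of \<open>x\<close> has
  larger height than \<open>x\<close>. The obstacle is to reach such vectors: for a vector
  \<open>v\<close> that is to be captured, \<open>p v\<close> has two components, which must be
  divided by \<open>p\<close> separately. This requires each component to be as divisible as their
  sum, which is why the invariant speaks of heights, transfinite ones included. The invariant also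
  keeps the number of occurring heights finite, which a union of a chain may destroy. Hence
  countability: the invariant holds at every finite stage, and only the grading itself has to pass
  to the union.\<close>

locale graded_module = module scale
  for scale :: "'r::comm_ring_1 \<Rightarrow> 'v::ab_group_add \<Rightarrow> 'v" (infixr \<open>*s\<close> 75) +
  fixes H :: "bool \<Rightarrow> 'r set"
  assumes H_one: "1 \<in> H False"
    and H_diff: "f \<in> H d \<Longrightarrow> g \<in> H d \<Longrightarrow> f - g \<in> H d"
    and H_mult: "f \<in> H c \<Longrightarrow> g \<in> H d \<Longrightarrow> f * g \<in> H (c \<noteq> d)"
    and H_decomp: "\<exists>f0\<in>H False. \<exists>f1\<in>H True. f = f0 + f1"
    and H_disjoint: "f \<in> H False \<Longrightarrow> f \<in> H True \<Longrightarrow> f = 0"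
begin

lemma H_zero: "0 \<in> H d"
proof -
  obtain f where "f \<in> H d" using H_decomp[of 1] by (cases d) auto
  from H_diff[OF this this] show ?thesis by simp
qed

lemma H_minus: "f \<in> H d \<Longrightarrow> - f \<in> H d"
  using H_diff[OF H_zero] by fastforce

lemma H_add: "f \<in> H d \<Longrightarrow> g \<in> H d \<Longrightarrow> f + g \<in> H d"
  using H_diff[OF _ H_minus] by fastforce

lemma H_decomp_at: "\<exists>f0\<in>H b. \<exists>f1\<in>H (\<not> b). f = f0 + f1"
proof (cases b)
  case True
  thus ?thesis using H_decomp[of f] by (metis add.commute)
qed (use H_decomp[of f] in simp)

lemma H_mult_eq: "f \<in> H c \<Longrightarrow> g \<in> H d \<Longrightarrow> b = (c \<noteq> d) \<Longrightarrow> f * g \<in> H b"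
  using H_mult by simp

lemma H_disjoint_at: "f \<in> H b \<Longrightarrow> f \<in> H (\<not> b) \<Longrightarrow> f = 0"
  using H_disjoint by (cases b) auto

text \<open>\<open>b \<noteq> d\<close> is addition of degrees modulo 2. A grading need not exhaust
  the module; \<open>total G\<close> is the submodule that it grades, so partial gradings can be
  enlarged.\<close>

definition grading :: "(bool \<Rightarrow> 'v set) \<Rightarrow> bool" where
  "grading G \<longleftrightarrow> (\<forall>b. 0 \<in> G b) \<and> (\<forall>b. \<forall>x\<in>G b. \<forall>y\<in>G b. x + y \<in> G b) \<and>
     (\<forall>b d. \<forall>f\<in>H d. \<forall>x\<in>G b. f *s x \<in> G (b \<noteq> d)) \<and> G True \<inter> G False \<subseteq> {0}"

definition total :: "(bool \<Rightarrow> 'v set) \<Rightarrow> 'v set" where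
  "total G = {x + y | x y. x \<in> G True \<and> y \<in> G False}"

lemma total_iff: "z \<in> total G \<longleftrightarrow> (\<exists>x\<in>G b. \<exists>y\<in>G (\<not> b). z = x + y)"
proof (cases b)
  case True thus ?thesis unfolding total_def by auto
next
  case False
  have "(\<exists>x\<in>G True. \<exists>y\<in>G False. z = x + y) \<longleftrightarrow> (\<exists>x\<in>G False. \<exists>y\<in>G True. z = x + y)"
    by (metis add.commute)
  thus ?thesis using False unfolding total_def by auto
qed

lemma totalI: "x \<in> G b \<Longrightarrow> y \<in> G (\<not> b) \<Longrightarrow> x + y \<in> total G"
  using total_iff by blast

lemma totalE:
  assumes "z \<in> total G" obtains x y where "x \<in> G b" "y \<in> G (\<not> b)" "z = x + y"
  using assms total_iff by blast

lemma total_mono: "(\<And>b. G b \<subseteq> G' b) \<Longrightarrow> total G \<subseteq> total G'"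
  unfolding total_def by blast

context
  fixes G assumes G: "grading G"
begin

lemma grading_zero: "0 \<in> G b"
  and grading_add: "x \<in> G b \<Longrightarrow> y \<in> G b \<Longrightarrow> x + y \<in> G b"
  and grading_scale: "f \<in> H d \<Longrightarrow> x \<in> G b \<Longrightarrow> f *s x \<in> G (b \<noteq> d)"
  using G unfolding grading_def by blast+

lemma grading_scale_eq: "f \<in> H d \<Longrightarrow> x \<in> G b \<Longrightarrow> c = (b \<noteq> d) \<Longrightarrow> f *s x \<in> G c"
  using grading_scale by simp

lemma grading_minus: "x \<in> G b \<Longrightarrow> - x \<in> G b"
  using grading_scale[OF H_minus[OF H_one], of x b] by simp

lemma grading_diff: "x \<in> G b \<Longrightarrow> y \<in> G b \<Longrightarrow> x - y \<in> G b"
  using grading_add[OF _ grading_minus] by fastforce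

lemma grading_disjoint: "x \<in> G b \<Longrightarrow> x \<in> G (\<not> b) \<Longrightarrow> x = 0"
  using G unfolding grading_def by (cases b) auto

lemma grading_unique:
  assumes "x \<in> G b" "y \<in> G (\<not> b)" "x' \<in> G b" "y' \<in> G (\<not> b)" "x + y = x' + y'"
  shows "x = x'" "y = y'"
proof -
  have "x - x' = y' - y" using assms(5) by (simp add: algebra_simps)
  moreover have "x - x' \<in> G b" "y' - y \<in> G (\<not> b)"
    using assms grading_diff by blast+
  ultimately have "x - x' = 0" using grading_disjoint by metis
  thus "x = x'" "y = y'" using assms(5) by auto
qed

lemma subset_total: "G b \<subseteq> total G"
  using totalI[OF _ grading_zero] by fastforce

lemma total_scale: "x \<in> total G \<Longrightarrow> f *s x \<in> total G"
proof -
  assume "x \<in> total G"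
  then obtain x1 x0 where x: "x1 \<in> G True" "x0 \<in> G (\<not> True)" "x = x1 + x0" by (rule totalE)
  obtain f0 f1 where f: "f0 \<in> H False" "f1 \<in> H True" "f = f0 + f1" using H_decomp by blast
  have "f *s x = (f0 *s x1 + f1 *s x0) + (f1 *s x1 + f0 *s x0)"
    using x(3) f(3) by (simp add: algebra_simps)
  moreover have "f0 *s x1 + f1 *s x0 \<in> G True" "f1 *s x1 + f0 *s x0 \<in> G (\<not> True)"
    using grading_add[of _ True] grading_add[of _ False] grading_scale[OF f(1) x(1)]
      grading_scale[OF f(1) x(2)] grading_scale[OF f(2) x(1)] grading_scale[OF f(2) x(2)]
    by simp_all
  ultimately show ?thesis using totalI by metis
qed

lemma subspace_total: "subspace (total G)"
proof (rule subspaceI)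
  show "0 \<in> total G" using subset_total grading_zero by blast
  show "x + y \<in> total G" if "x \<in> total G" "y \<in> total G" for x y
  proof -
    obtain x1 x0 where x: "x1 \<in> G True" "x0 \<in> G (\<not> True)" "x = x1 + x0"
      using \<open>x \<in> total G\<close> by (rule totalE)
    obtain y1 y0 where y: "y1 \<in> G True" "y0 \<in> G (\<not> True)" "y = y1 + y0"
      using \<open>y \<in> total G\<close> by (rule totalE)
    have "x + y = (x1 + y1) + (x0 + y0)" using x y by (simp add: algebra_simps)
    thus ?thesis using totalI[OF grading_add[OF x(1) y(1)] grading_add[OF x(2) y(2)]] by simp
  qed
qed (rule total_scale)

end

end

section \<open>Primary modules and heights\<close>

locale graded_primary = graded_module scale H
  for scale :: "'r::comm_ring_1 \<Rightarrow> 'v::ab_group_add \<Rightarrow> 'v" (infixr \<open>*s\<close> 75) and H +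
  fixes p :: 'r and e :: bool and W :: "'v set"
  assumes p_homogeneous: "p \<in> H e"
    and p_maximal: "p dvd f \<or> (\<exists>a b. a * f + b * p = 1)"
    and subspace_W: "subspace W"
    and W_primary: "x \<in> W \<Longrightarrow> \<exists>n. p ^ n *s x = 0"
begin

text \<open>Since \<open>p\<close> is homogeneous, the degree parts of \<open>p * g\<close> are
  \<open>p\<close> times the degree parts of \<open>g\<close>.\<close>

lemma p_dvd_components:
  assumes "f0 \<in> H b" "f1 \<in> H (\<not> b)" "p dvd f0 + f1"
  shows "\<exists>g\<in>H (b \<noteq> e). f0 = g * p" 
proof -
  obtain g where g: "f0 + f1 = p * g" using assms(3) by (rule dvdE)
  obtain g0 g1 where h: "g0 \<in> H (b \<noteq> e)" "g1 \<in> H (\<not> (b \<noteq> e))" "g = g0 + g1"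
    using H_decomp_at by blast
  have "f0 - g0 * p = g1 * p - f1" using g h by (simp add: algebra_simps)
  moreover have "f0 - g0 * p \<in> H b"
    using h p_homogeneous assms by (intro H_diff H_mult_eq[of _ "b \<noteq> e" _ e]) auto
  moreover have "g1 * p - f1 \<in> H (\<not> b)"
    using h p_homogeneous assms by (intro H_diff H_mult_eq[of _ "\<not> (b \<noteq> e)" _ e]) auto
  ultimately have "f0 - g0 * p = 0" using H_disjoint_at by metis
  thus ?thesis using h by auto
qed

text \<open>
  The submodules \<open>p\<^sup>\<alpha> W\<close> for all ordinals \<open>\<alpha>\<close>. The smallest member that contains \<open>x\<close> plays the role of
  the height of \<open>x\<close>; smaller members mean larger heights.
\<close>

inductive_set tower :: "'v set set" where
  top: "W \<in> tower"
| mult: "A \<in> tower \<Longrightarrow> scale p ` A \<in> tower"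
| Inter: "M \<noteq> {} \<Longrightarrow> (\<And>A. A \<in> M \<Longrightarrow> A \<in> tower) \<Longrightarrow> \<Inter>M \<in> tower"

lemma tower_subset: "A \<in> tower \<Longrightarrow> A \<subseteq> W"
proof (induction rule: tower.induct)
  case (mult A) thus ?case using subspace_scale[OF subspace_W] by blast
qed auto

lemma tower_subspace: "A \<in> tower \<Longrightarrow> subspace A"
proof (induction rule: tower.induct)
  case (mult A)
  show ?case
  proof (rule subspaceI)
    show "0 \<in> scale p ` A" using subspace_0[OF mult.IH] by (metis image_eqI scale_zero_right)
    fix x assume "x \<in> scale p ` A"
    then obtain a where a: "a \<in> A" "x = p *s a" by blast
    show "c *s x \<in> scale p ` A" for c
    proof
      show "c *s x = p *s (c *s a)" using a scale_left_commute by simp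
    qed (use a subspace_scale[OF mult.IH] in blast)
    fix y assume "y \<in> scale p ` A"
    then obtain b where b: "b \<in> A" "y = p *s b" by blast
    show "x + y \<in> scale p ` A"
    proof
      show "x + y = p *s (a + b)" using a b by (simp add: scale_right_distrib)
    qed (use a b subspace_add[OF mult.IH] in blast)
  qed
next
  case (Inter M) thus ?case by (auto simp: subspace_Inter)
qed (rule subspace_W)

lemma tower_mult_subset: "A \<in> tower \<Longrightarrow> scale p ` A \<subseteq> A"
  using subspace_scale[OF tower_subspace] by blast

text \<open>Stronger than comparability: no member lies strictly between \<open>p B\<close> and
  \<open>B\<close>. This gap is what carries the induction from \<open>A\<close> to
  \<open>p A\<close>, and it replaces the well-ordering of heights.\<close>

lemma tower_compare_mult: "A \<in> tower \<Longrightarrow> B \<in> tower \<Longrightarrow> B \<subseteq> A \<or> A \<subseteq> scale p ` B"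
proof (induction arbitrary: B rule: tower.induct)
  case top thus ?case using tower_subset by blast
next
  case (Inter M) thus ?case by blast
next
  case (mult A)
  \<comment> \<open>The inner induction compares \<open>B\<close> with \<open>p A\<close>; from
    \<open>A \<subseteq> B\<close> the wanted \<open>p A \<subseteq> p B\<close> follows.\<close>
  have "B \<subseteq> scale p ` A \<or> A \<subseteq> B" using \<open>B \<in> tower\<close>
  proof (induction rule: tower.induct)
    case top show ?case using tower_subset[OF mult.hyps] by blast
  next
    case (mult B)
    have "scale p ` B \<subseteq> B" using tower_mult_subset mult.hyps by blast
    thus ?case using mult.IH \<open>\<And>B. B \<in> tower \<Longrightarrow> B \<subseteq> A \<or> A \<subseteq> scale p ` B\<close>[OF mult.hyps] by blast
  next
    case (Inter M) thus ?case by blast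
  qed
  thus ?case by blast
qed

lemma tower_chain: "A \<in> tower \<Longrightarrow> B \<in> tower \<Longrightarrow> A \<subseteq> B \<or> B \<subseteq> A"
  using tower_compare_mult[of A B] tower_mult_subset[of B] by blast

text \<open>Such an \<open>A\<close> is \<open>p\<close>-divisible, so it survives every
  multiplication by \<open>p\<close> and every intersection: it is the divisible part of
  \<open>W\<close>, where the descending chain becomes stationary.\<close>

lemma tower_stable_least:
  assumes "A \<in> tower" "A \<subseteq> scale p ` A" "B \<in> tower" shows "A \<subseteq> B"
  using assms(3)
proof (induction rule: tower.induct)
  case top show ?case using tower_subset assms by blast
qed (use assms in blast)+

lemma tower_Inter:
  assumes "M \<subseteq> tower" "M \<noteq> {}" shows "\<Inter>M \<in> tower"
  using assms tower.Inter by blast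

text \<open>The last condition, that only finitely many heights occur, replaces finite length of \<open>total S\<close>.\<close>

definition good :: "(bool \<Rightarrow> 'v set) \<Rightarrow> bool" where
  "good S \<longleftrightarrow> grading S \<and> total S \<subseteq> W \<and>
     (\<forall>A\<in>tower. \<forall>x\<in>S True. \<forall>y\<in>S False. x + y \<in> A \<longrightarrow> x \<in> A) \<and>
     finite ((\<lambda>A. total S \<inter> A) ` tower)"

text \<open>No element of the coset of \<open>x\<close> has larger height than \<open>x\<close>.\<close>

definition proper :: "(bool \<Rightarrow> 'v set) \<Rightarrow> 'v \<Rightarrow> bool" where
  "proper S x \<longleftrightarrow> (\<forall>A\<in>tower. \<forall>s\<in>total S. x + s \<in> A \<longrightarrow> x \<in> A)"

lemma good_components:
  assumes "good S" "A \<in> tower" "x \<in> S b" "y \<in> S (\<not> b)" "x + y \<in> A"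
  shows "x \<in> A" "y \<in> A"
proof -
  have sub: "subspace A" using assms tower_subspace by blast
  have "x \<in> A \<or> y \<in> A"
  proof (cases b)
    case True thus ?thesis using assms unfolding good_def by auto
  next
    case False
    hence "y + x \<in> A" "y \<in> S True" "x \<in> S False" using assms by (auto simp: add.commute)
    thus ?thesis using assms unfolding good_def by blast
  qed
  thus "x \<in> A" "y \<in> A" using assms(5) subspace_diff[OF sub]
    by (metis add_diff_cancel_left' add_diff_cancel_right')+
qed

lemma good_grading: "good S \<Longrightarrow> grading S"
  by (simp add: good_def)

text \<open>Among the members that meet the coset, take one with minimal trace on \<open>T\<close>.
  If a smaller member meets the coset too, the difference of the two vectors lies in the common
  trace, so the first vector is already in the smaller member.\<close>

lemma coset_max:
  assumes sub: "\<And>x y. x \<in> T \<Longrightarrow> y \<in> T \<Longrightarrow> x - y \<in> T" "T \<noteq> {}"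
    and fin: "finite ((\<lambda>A. T \<inter> A) ` tower)" and v: "v \<in> W" "T \<subseteq> W"
  obtains s where "s \<in> T" "\<And>A s'. A \<in> tower \<Longrightarrow> s' \<in> T \<Longrightarrow> v + s' \<in> A \<Longrightarrow> v + s \<in> A"
proof -
  define M where "M = {A \<in> tower. \<exists>s\<in>T. v + s \<in> A}"
  have W: "W \<in> M" unfolding M_def using tower.top v sub subspace_add[OF subspace_W] by blast
  have "finite ((\<lambda>A. T \<inter> A) ` M)" by (rule finite_subset[OF _ fin]) (auto simp: M_def)
  moreover have "(\<lambda>A. T \<inter> A) ` M \<noteq> {}" using W by blast
  ultimately obtain X where X: "X \<in> (\<lambda>A. T \<inter> A) ` M" "\<And>Y. Y \<in> (\<lambda>A. T \<inter> A) ` M \<Longrightarrow> Y \<subseteq> X \<Longrightarrow> X = Y"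
    using finite_has_minimal by metis
  then obtain A0 s where A0: "A0 \<in> tower" "X = T \<inter> A0" "s \<in> T" "v + s \<in> A0"
    unfolding M_def by auto
  have "v + s \<in> A" if A: "A \<in> tower" "s' \<in> T" "v + s' \<in> A" for A s'
  proof (cases "A0 \<subseteq> A")
    case False
    hence "A \<subseteq> A0" using tower_chain A A0 by blast
    have "T \<inter> A \<in> (\<lambda>A. T \<inter> A) ` M" using A unfolding M_def by blast
    hence eq: "T \<inter> A0 = T \<inter> A" using X(2) A0 \<open>A \<subseteq> A0\<close> by blast
    have "(v + s) - (v + s') \<in> A0"
      using subspace_diff[OF tower_subspace[OF A0(1)]] A0 A \<open>A \<subseteq> A0\<close> by blast
    hence "s - s' \<in> A" using sub A0 A eq by auto
    hence "(s - s') + (v + s') \<in> A" using subspace_add[OF tower_subspace] A by blast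
    thus ?thesis by (simp add: algebra_simps)
  qed (use A0 in blast)
  thus thesis using that A0 by blast
qed


section \<open>Adjoining one homogeneous vector\<close>

definition adjoin :: "(bool \<Rightarrow> 'v set) \<Rightarrow> bool \<Rightarrow> 'v \<Rightarrow> bool \<Rightarrow> 'v set" where
  "adjoin S b x c = {s + f *s x | s f. s \<in> S c \<and> f \<in> H (b \<noteq> c)}"

lemma adjoinI: "s \<in> S c \<Longrightarrow> f \<in> H (b \<noteq> c) \<Longrightarrow> s + f *s x \<in> adjoin S b x c"
  unfolding adjoin_def by blast

lemma adjoinE:
  assumes "y \<in> adjoin S b x c"
  obtains s f where "s \<in> S c" "f \<in> H (b \<noteq> c)" "y = s + f *s x"
  using assms unfolding adjoin_def by blast

lemma total_adjoin:
  assumes "grading S"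
  shows "total (adjoin S b x) = {s + f *s x | s f. s \<in> total S}"
proof (intro equalityI subsetI)
  fix z assume "z \<in> total (adjoin S b x)"
  then obtain y1 y0 where y: "y1 \<in> adjoin S b x True" "y0 \<in> adjoin S b x (\<not> True)" "z = y1 + y0"
    by (rule totalE)
  obtain s1 f1 where 1: "s1 \<in> S True" "y1 = s1 + f1 *s x" using y(1) by (rule adjoinE)
  obtain s0 f0 where 0: "s0 \<in> S (\<not> True)" "y0 = s0 + f0 *s x" using y(2) by (rule adjoinE)
  have "z = (s1 + s0) + (f1 + f0) *s x" using y 0 1 by (simp add: algebra_simps)
  thus "z \<in> {s + f *s x | s f. s \<in> total S}" using totalI[OF 1(1) 0(1)] by blast
next
  fix z assume "z \<in> {s + f *s x | s f. s \<in> total S}"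
  then obtain s f where z: "s \<in> total S" "z = s + f *s x" by blast
  obtain s1 s0 where s: "s1 \<in> S b" "s0 \<in> S (\<not> b)" "s = s1 + s0" using z(1) by (rule totalE)
  obtain f1 f0 where f: "f1 \<in> H False" "f0 \<in> H (\<not> False)" "f = f1 + f0" using H_decomp_at by blast
  have "z = (s1 + f1 *s x) + (s0 + f0 *s x)" using z s f by (simp add: algebra_simps)
  moreover have "s1 + f1 *s x \<in> adjoin S b x b" using s f by (intro adjoinI) auto
  moreover have "s0 + f0 *s x \<in> adjoin S b x (\<not> b)" using s f by (intro adjoinI) auto
  ultimately show "z \<in> total (adjoin S b x)" using totalI by blast
qed

lemma subset_adjoin: "S c \<subseteq> adjoin S b x c"
  using adjoinI[OF _ H_zero] by fastforce

lemma mem_adjoin: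
  assumes "grading S" shows "x \<in> adjoin S b x b"
proof -
  have "0 + 1 *s x \<in> adjoin S b x b" using assms by (intro adjoinI grading_zero) (simp_all add: H_one)
  thus ?thesis by simp
qed

text \<open>Admitting \<open>A = {0}\<close> lets one argument give both compatibility with heights
  and directness of the enlarged sum. If \<open>p\<close> divides the coefficient of
  \<open>x\<close>, everything lies in \<open>total S\<close> already. Otherwise the coefficient is
  invertible modulo \<open>p\<close>, so a multiple of the vector has the form \<open>x + s\<close>,
  where properness, or \<open>x \<notin> total S\<close> for \<open>A = {0}\<close>,
  decides.\<close>

lemma adjoin_components:
  assumes S: "good S" and x: "x \<notin> total S" "p *s x \<in> S (b \<noteq> e)" "proper S x"
    and A: "A \<in> tower \<or> A = {0}"
    and mem: "s0 \<in> S c" "s1 \<in> S (\<not> c)" "f0 \<in> H (b \<noteq> c)" "f1 \<in> H (\<not> (b \<noteq> c))"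
      "(s0 + f0 *s x) + (s1 + f1 *s x) \<in> A"
  shows "s0 + f0 *s x \<in> A"
proof -
  note g = good_grading[OF S]
  have subA: "subspace A" using A tower_subspace subspace_single_0 by blast
  consider "p dvd f0 + f1" | k l where "k * (f0 + f1) + l * p = 1" using p_maximal by blast
  thus ?thesis
  proof cases
    case 1
    obtain g0 where g0: "g0 \<in> H ((b \<noteq> c) \<noteq> e)" "f0 = g0 * p"
      using p_dvd_components[OF mem(3,4) 1] by blast
    obtain g1 where g1: "g1 \<in> H ((\<not> (b \<noteq> c)) \<noteq> e)" "f1 = g1 * p"
      using p_dvd_components[of f1 "\<not> (b \<noteq> c)" f0] mem(3,4) 1 by (auto simp: add.commute)
    have "f0 *s x = g0 *s (p *s x)" "f1 *s x = g1 *s (p *s x)" using g0 g1 by auto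
    moreover have "g0 *s (p *s x) \<in> S c" by (rule grading_scale_eq[OF g g0(1) x(2)]) auto
    moreover have "g1 *s (p *s x) \<in> S (\<not> c)" by (rule grading_scale_eq[OF g g1(1) x(2)]) auto
    ultimately have "f0 *s x \<in> S c" "f1 *s x \<in> S (\<not> c)" by simp_all
    hence *: "s0 + f0 *s x \<in> S c" "s1 + f1 *s x \<in> S (\<not> c)" using grading_add[OF g] mem by auto
    show ?thesis
    proof (cases "A \<in> tower")
      case True
      thus ?thesis using good_components[OF S True *] mem by blast
    next
      case False
      hence "s0 + f0 *s x = 0" using grading_unique(1)[OF g *(1,2) grading_zero[OF g] grading_zero[OF g]] mem A
        by simp
      thus ?thesis using False A by simp
    qed
  next
    case 2
    define s where "s = k *s (s0 + s1) - l *s (p *s x)"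
    have "s0 + s1 \<in> total S" using totalI mem by blast
    moreover have "p *s x \<in> total S" using subset_total[OF g] x by blast
    ultimately have s: "s \<in> total S" unfolding s_def
      using subspace_diff[OF subspace_total[OF g]] total_scale[OF g] by blast
    have "k *s ((s0 + f0 *s x) + (s1 + f1 *s x)) = k *s (s0 + s1) + (k * (f0 + f1)) *s x"
      by (simp add: algebra_simps)
    also have "k * (f0 + f1) = 1 - l * p" using 2 by (simp add: algebra_simps)
    finally have "x + s = k *s ((s0 + f0 *s x) + (s1 + f1 *s x))"
      by (simp add: s_def algebra_simps)
    hence xs: "x + s \<in> A" using mem subspace_scale[OF subA] by metis
    show ?thesis
    proof (cases "A \<in> tower")
      case True
      hence xA: "x \<in> A" using xs s x(3) unfolding proper_def by blast
      have "(s0 + s1) = ((s0 + f0 *s x) + (s1 + f1 *s x)) - (f0 + f1) *s x"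
        by (simp add: algebra_simps)
      hence "s0 + s1 \<in> A" using mem xA subspace_diff[OF subA] subspace_scale[OF subA] by metis
      hence "s0 \<in> A" using good_components[OF S True mem(1,2)] by blast
      thus ?thesis using xA subspace_add[OF subA] subspace_scale[OF subA] by blast
    next
      case False
      hence "x = - s" using xs A by (simp add: eq_neg_iff_add_eq_0)
      hence "x \<in> total S" using subspace_neg[OF subspace_total[OF g] s] by simp
      thus ?thesis using x by blast
    qed
  qed
qed

lemma good_adjoin:
  assumes S: "good S" and x: "x \<in> W" "x \<notin> total S" "p *s x \<in> S (b \<noteq> e)" "proper S x"
  shows "good (adjoin S b x)"
  unfolding good_def
proof (intro conjI)
  note g = good_grading[OF S]
  note comps = adjoin_components[OF S x(2-4)]
  have SW: "total S \<subseteq> W" using S unfolding good_def by blast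
  show "grading (adjoin S b x)"
    unfolding grading_def
  proof (intro conjI allI ballI)
    show "0 \<in> adjoin S b x c" for c using subset_adjoin grading_zero[OF g] by blast
    show "y + z \<in> adjoin S b x c" if yz: "y \<in> adjoin S b x c" "z \<in> adjoin S b x c" for c y z
    proof -
      obtain s f where y: "s \<in> S c" "f \<in> H (b \<noteq> c)" "y = s + f *s x" using yz(1) by (rule adjoinE)
      obtain t h where z: "t \<in> S c" "h \<in> H (b \<noteq> c)" "z = t + h *s x" using yz(2) by (rule adjoinE)
      have "y + z = (s + t) + (f + h) *s x" using y z by (simp add: algebra_simps)
      moreover have "(s + t) + (f + h) *s x \<in> adjoin S b x c"
        using y z by (intro adjoinI grading_add[OF g] H_add)
      ultimately show ?thesis by simp
    qed
    show "h *s y \<in> adjoin S b x (c \<noteq> d)" if hy: "h \<in> H d" "y \<in> adjoin S b x c" for c d h y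
    proof -
      obtain s f where y: "s \<in> S c" "f \<in> H (b \<noteq> c)" "y = s + f *s x" using hy(2) by (rule adjoinE)
      have "h *s y = h *s s + (h * f) *s x" using y by (simp add: algebra_simps)
      moreover have "h * f \<in> H (b \<noteq> (c \<noteq> d))" by (rule H_mult_eq[OF hy(1) y(2)]) auto
      ultimately show ?thesis using adjoinI[of "h *s s" S "c \<noteq> d" "h * f" b x] grading_scale[OF g hy(1) y(1)] by simp
    qed
    show "adjoin S b x True \<inter> adjoin S b x False \<subseteq> {0}"
    proof
      fix y assume "y \<in> adjoin S b x True \<inter> adjoin S b x False"
      then obtain s f t h where y: "s \<in> S True" "f \<in> H (b \<noteq> True)" "y = s + f *s x"
        "t \<in> S False" "h \<in> H (b \<noteq> False)" "y = t + h *s x" by (auto elim!: adjoinE)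
      have "- t \<in> S (\<not> True)" "- h \<in> H (\<not> (b \<noteq> True))"
        using grading_minus[OF g y(4)] H_minus[OF y(5)] by auto
      moreover have "(s + f *s x) + (- t + (- h) *s x) \<in> {0}"
        using y(3,6) by (simp add: algebra_simps)
      ultimately have "s + f *s x \<in> {0}" using comps[of "{0}" s True "- t" f "- h"] y(1,2) by blast
      thus "y \<in> {0}" using y by simp
    qed
  qed
  show "total (adjoin S b x) \<subseteq> W"
    using total_adjoin[OF g] SW subspace_add[OF subspace_W] subspace_scale[OF subspace_W] x(1) by auto
  show "\<forall>A\<in>tower. \<forall>y\<in>adjoin S b x True. \<forall>z\<in>adjoin S b x False. y + z \<in> A \<longrightarrow> y \<in> A"
  proof (intro ballI impI)
    fix A y z assume A: "A \<in> tower" and yz: "y \<in> adjoin S b x True" "z \<in> adjoin S b x False" "y + z \<in> A"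
    obtain s f where y: "s \<in> S True" "f \<in> H (b \<noteq> True)" "y = s + f *s x" using yz(1) by (rule adjoinE)
    obtain t h where z: "t \<in> S False" "h \<in> H (b \<noteq> False)" "z = t + h *s x" using yz(2) by (rule adjoinE)
    show "y \<in> A" using comps[of A s True t f h] A y z yz(3) by auto
  qed
  show "finite ((\<lambda>A. total (adjoin S b x) \<inter> A) ` tower)"
  proof (rule finite_subset)
    let ?F = "(\<lambda>A. total S \<inter> A) ` tower"
    \<comment> \<open>A member containing \<open>x\<close> meets the new submodule in its old trace
      plus the multiples of \<open>x\<close>; a member missing \<open>x\<close> meets it in the old
      trace, by properness. So the number of traces at most doubles.\<close>
    show "finite (?F \<union> (\<lambda>X. {s + f *s x | s f. s \<in> X}) ` ?F)" using S unfolding good_def by blast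
    show "(\<lambda>A. total (adjoin S b x) \<inter> A) ` tower \<subseteq> ?F \<union> (\<lambda>X. {s + f *s x | s f. s \<in> X}) ` ?F"
    proof (rule image_subsetI)
      fix A assume A: "A \<in> tower"
      note subA = tower_subspace[OF A]
      show "total (adjoin S b x) \<inter> A \<in> ?F \<union> (\<lambda>X. {s + f *s x | s f. s \<in> X}) ` ?F"
      proof (cases "x \<in> A")
        case True
        have "total (adjoin S b x) \<inter> A = {s + f *s x | s f. s \<in> total S \<inter> A}"
        proof (intro equalityI subsetI)
          fix y assume "y \<in> total (adjoin S b x) \<inter> A"
          then obtain s f where y: "s \<in> total S" "y = s + f *s x" "y \<in> A" using total_adjoin[OF g] by auto
          have "s = y - f *s x" using y by simp
          hence "s \<in> A" using subspace_diff[OF subA] subspace_scale[OF subA] True y by metis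
          thus "y \<in> {s + f *s x | s f. s \<in> total S \<inter> A}" using y by blast
        next
          fix y assume "y \<in> {s + f *s x | s f. s \<in> total S \<inter> A}"
          thus "y \<in> total (adjoin S b x) \<inter> A"
            using total_adjoin[OF g] subspace_add[OF subA] subspace_scale[OF subA True] by auto
        qed
        thus ?thesis using A by blast
      next
        case False
        have "total (adjoin S b x) \<inter> A = total S \<inter> A"
        proof (intro equalityI subsetI)
          fix y assume "y \<in> total (adjoin S b x) \<inter> A"
          then obtain s f where y: "s \<in> total S" "y = s + f *s x" "y \<in> A" using total_adjoin[OF g] by auto
          consider "p dvd f" | k l where "k * f + l * p = 1" using p_maximal by blast
          hence "y \<in> total S"
          proof cases
            case 1
            then obtain h where "f = p * h" by (rule dvdE)
            hence "f *s x = h *s (p *s x)" by (simp add: mult.commute)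
            thus ?thesis using y total_scale[OF g] x(3) subset_total[OF g] subspace_add[OF subspace_total[OF g]]
              by (metis subsetD)
          next
            case 2
            define t where "t = k *s s - l *s (p *s x)"
            have "t \<in> total S" unfolding t_def
              using y x(3) subset_total[OF g] subspace_diff[OF subspace_total[OF g]] total_scale[OF g] by blast
            moreover have "k * f = 1 - l * p" using 2 by (simp add: algebra_simps)
            hence "(k * f) *s x = x - l *s (p *s x)" by (simp add: scale_left_diff_distrib)
            ultimately have "x + t = k *s y" using y by (simp add: t_def scale_right_distrib)
            hence "x + t \<in> A" using y subspace_scale[OF subA] by metis
            hence "x \<in> A" using x(4) A \<open>t \<in> total S\<close> unfolding proper_def by blast
            thus ?thesis using False by blast
          qed
          thus "y \<in> total S \<inter> A" using y by blast
        next
          fix y assume "y \<in> total S \<inter> A"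
          thus "y \<in> total (adjoin S b x) \<inter> A" using total_mono[of S "adjoin S b x"] subset_adjoin by blast
        qed
        thus ?thesis using A by blast
      qed
    qed
  qed
qed


section \<open>Dividing homogeneous vectors by \<open>p\<close>\<close>

text \<open>\<open>H0\<close>, the height of \<open>s\<close>, is the largest height, a successor or
  a limit. At a successor, a coset vector \<open>x + r\<close> higher than \<open>x\<close> would
  yield, after multiplication by \<open>p\<close> and passage to one component, some
  \<open>s + p a\<close> higher than \<open>s\<close>, against \<open>max\<close>. At a limit, the
  finitely many heights in \<open>total S\<close> leave a gap above \<open>H0\<close>, and the
  preimage is taken inside it.\<close>

lemma lift_maximal:
  assumes S: "good S" and s: "s \<in> S (b \<noteq> e)" and B: "B \<in> tower" "s \<in> scale p ` B"
    and max: "\<And>a A. a \<in> S b \<Longrightarrow> a \<in> B \<Longrightarrow> A \<in> tower \<Longrightarrow> s + p *s a \<in> A \<Longrightarrow> s \<in> A"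
  obtains x where "x \<in> B" "p *s x = s" "proper S x"
proof -
  note g = good_grading[OF S]
  define H0 where "H0 = \<Inter>{A \<in> tower. s \<in> A}"
  have pB: "scale p ` B \<in> tower" using B tower.mult by blast
  have H0: "H0 \<in> tower" unfolding H0_def by (rule tower_Inter) (use pB B in auto)
  have sH: "s \<in> H0" unfolding H0_def by blast
  have least: "H0 \<subseteq> A" if "A \<in> tower" "s \<in> A" for A unfolding H0_def using that by blast
  have HpB: "H0 \<subseteq> scale p ` B" using least pB B by blast
  have HB: "H0 \<subseteq> B" using HpB tower_mult_subset B by blast
  consider (stable) "H0 \<subseteq> scale p ` H0"
    | (succ) C where "\<not> H0 \<subseteq> scale p ` H0" "C \<in> tower" "H0 = scale p ` C"
    | (limit) "\<not> H0 \<subseteq> scale p ` H0" "\<And>C. C \<in> tower \<Longrightarrow> H0 \<noteq> scale p ` C" by blast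
  thus thesis
  proof cases
    case stable
    then obtain x where x: "x \<in> H0" "s = p *s x" using sH by blast
    have "proper S x" unfolding proper_def
      using tower_stable_least[OF H0 stable] x by blast
    thus thesis using that x HB by blast
  next
    case succ
    \<comment> \<open>If \<open>B \<subseteq> C\<close>, then
      \<open>H0 \<subseteq> p B \<subseteq> p C = H0\<close>, so \<open>B\<close> itself can
      serve.\<close>
    obtain D where D: "D \<in> tower" "H0 = scale p ` D" "D \<subseteq> B"
    proof (cases "C \<subseteq> B")
      case False
      hence "B \<subseteq> C" using tower_chain succ B by blast
      hence "H0 = scale p ` B" using HpB succ by blast
      thus ?thesis using that B by blast
    qed (use that succ in blast)
    obtain x where x: "x \<in> D" "s = p *s x" using D sH by blast
    have "x \<in> A" if A: "A \<in> tower" and r: "r \<in> total S" "x + r \<in> A" for A r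
    proof (rule ccontr)
      assume "x \<notin> A"
      hence AH: "A \<subseteq> H0" using tower_compare_mult[OF A D(1)] x D by blast
      hence AD: "A \<subseteq> D" using D tower_mult_subset by blast
      obtain r1 r0 where rr: "r1 \<in> S b" "r0 \<in> S (\<not> b)" "r = r1 + r0" using r(1) by (rule totalE)
      have "r \<in> D" using subspace_diff[OF tower_subspace[OF D(1)], of "x + r" x] r AD x by auto
      hence "r1 \<in> B" using good_components[OF S D(1) rr(1,2)] rr D by blast
      have pA: "scale p ` A \<in> tower" using A tower.mult by blast
      have r1: "s + p *s r1 \<in> S (b \<noteq> e)"
        using grading_add[OF g s grading_scale[OF g p_homogeneous rr(1)]] .
      have r0: "p *s r0 \<in> S (\<not> (b \<noteq> e))"
        by (rule grading_scale_eq[OF g p_homogeneous rr(2)]) auto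
      have "p *s (x + r) = (s + p *s r1) + p *s r0"
        using x rr by (simp add: scale_right_distrib)
      hence "(s + p *s r1) + p *s r0 \<in> scale p ` A" using r by (metis image_eqI)
      hence "s + p *s r1 \<in> scale p ` A" by (rule good_components(1)[OF S pA r1 r0])
      hence "s \<in> scale p ` A" using max[OF rr(1) \<open>r1 \<in> B\<close> pA] by blast
      hence "H0 \<subseteq> scale p ` A" using least pA by blast
      thus False using AH succ(1) by blast
    qed
    hence "proper S x" unfolding proper_def by blast
    thus thesis using that x D by blast
  next
    case limit
    define M where "M = {A \<in> tower. H0 \<subset> A}"
    have "B \<in> M" unfolding M_def using B HB limit HpB tower_mult_subset by blast
    have M: "M \<subseteq> tower" "M \<noteq> {}" using \<open>B \<in> M\<close> M_def by auto
    \<comment> \<open>Otherwise this intersection \<open>U\<close> lies strictly above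
      \<open>H0\<close>, hence so does \<open>p U\<close>, which is then one of the intersected
      members. So \<open>U \<subseteq> p U\<close>, and \<open>U\<close> would be the least member
      of the tower.\<close>
    have eq: "\<Inter>M = H0"
    proof (rule ccontr)
      assume ne: "\<Inter>M \<noteq> H0"
      let ?U = "\<Inter>M"
      have U: "?U \<in> tower" using tower_Inter M by blast
      have "H0 \<subset> ?U" using ne M_def by blast
      hence HU: "H0 \<subseteq> scale p ` ?U" using tower_compare_mult[OF H0 U] by blast
      have pU: "scale p ` ?U \<in> tower" using tower.mult U by blast
      have "scale p ` ?U \<in> M" using HU limit(2)[OF U] pU unfolding M_def by blast
      hence "?U \<subseteq> scale p ` ?U" by blast
      hence "?U \<subseteq> H0" using tower_stable_least U H0 by blast
      thus False using \<open>H0 \<subset> ?U\<close> by blast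
    qed
    \<comment> \<open>By finiteness some \<open>A1\<close> strictly above \<open>H0\<close> contains
      no vectors of \<open>total S\<close> other than those in \<open>H0\<close>.\<close>
    have "finite ((\<lambda>A. total S \<inter> A) ` M)"
      using S M unfolding good_def by (meson finite_subset image_mono)
    moreover have "(\<lambda>A. total S \<inter> A) ` M \<noteq> {}" using M by blast
    ultimately obtain X where X: "X \<in> (\<lambda>A. total S \<inter> A) ` M"
      "\<And>Y. Y \<in> (\<lambda>A. total S \<inter> A) ` M \<Longrightarrow> Y \<subseteq> X \<Longrightarrow> X = Y"
      using finite_has_minimal by metis
    obtain A1 where A1: "A1 \<in> M" "X = total S \<inter> A1" using X(1) by blast
    have A1_least: "total S \<inter> A1 \<subseteq> A" if "A \<in> M" for A
    proof (cases "A1 \<subseteq> A")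
      case False
      hence "A \<subseteq> A1" using tower_chain that A1 M by blast
      thus ?thesis using X(2)[of "total S \<inter> A"] that A1 by blast
    qed blast
    hence A1H: "total S \<inter> A1 \<subseteq> H0" using eq by blast
    obtain C where C: "C \<in> M" "C \<subseteq> A1" "C \<subseteq> B"
      using tower_chain[of A1 B] A1 B \<open>B \<in> M\<close> M by blast
    have Ct: "C \<in> tower" using C M by blast
    have "\<not> C \<subseteq> H0" using C(1) M_def by blast
    hence "H0 \<subseteq> scale p ` C" using tower_compare_mult[OF H0 Ct] by blast
    then obtain x where x: "x \<in> C" "s = p *s x" using sH by blast
    have "x \<in> A" if A: "A \<in> tower" and r: "r \<in> total S" "x + r \<in> A" for A r
    proof (rule ccontr)
      assume xA: "x \<notin> A"
      hence "A \<subseteq> C" using tower_chain A Ct x by blast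
      hence "r \<in> C" using subspace_diff[OF tower_subspace[OF Ct], of "x + r" x] r x by auto
      hence rH: "r \<in> H0" using A1H C r by blast
      have "\<not> H0 \<subseteq> A"
      proof
        assume "H0 \<subseteq> A"
        hence "(x + r) - r \<in> A" using rH r subspace_diff[OF tower_subspace[OF A]] by blast
        thus False using xA by simp
      qed
      \<comment> \<open>Now \<open>x\<close> itself would lie in \<open>H0\<close>, so
        \<open>s \<in> p H0\<close> and \<open>H0\<close> would be stable.\<close>
      hence "A \<subseteq> H0" using tower_chain A H0 by blast
      hence "(x + r) - r \<in> H0" using rH r subspace_diff[OF tower_subspace[OF H0]] by blast
      hence "s \<in> scale p ` H0" using x by simp
      thus False using least[OF tower.mult[OF H0]] limit(1) by blast
    qed
    hence "proper S x" unfolding proper_def by blast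
    thus thesis using that x C by blast
  qed
qed

text \<open>\<open>s\<close> need not have maximal height modulo \<open>p (S b \<inter> B)\<close>.
  It is shifted by some \<open>p a\<close> that makes it so, a preimage of the shifted vector is
  adjoined, and \<open>a\<close> is subtracted again. The last conclusion bounds the growth of
  \<open>S\<close>: modulo \<open>B\<close> nothing is added, and after multiplication by
  \<open>p\<close> only multiples of \<open>s\<close> are.\<close>

lemma lift_homogeneous:
  assumes S: "good S" and s: "s \<in> S (b \<noteq> e)" and B: "B \<in> tower" "s \<in> scale p ` B"
  obtains S' x where "good S'" "\<And>c. S c \<subseteq> S' c" "x \<in> S' b" "x \<in> B" "p *s x = s"
    "\<And>y. y \<in> total S' \<Longrightarrow> \<exists>t\<in>total S. \<exists>f. y - t \<in> B \<and> p *s y = p *s t + f *s s"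
proof -
  note g = good_grading[OF S]
  note subB = tower_subspace[OF B(1)]
  have SW: "total S \<subseteq> W" using S unfolding good_def by blast
  define T where "T = scale p ` (S b \<inter> B)"
  have TS: "T \<subseteq> S (b \<noteq> e)" unfolding T_def using grading_scale[OF g p_homogeneous] by blast
  have "T = T \<inter> total S" using TS subset_total[OF g] by blast
  hence "(\<lambda>A. T \<inter> A) ` tower = (\<lambda>X. T \<inter> X) ` (\<lambda>A. total S \<inter> A) ` tower"
    unfolding image_image by (metis (no_types, lifting) inf_assoc)
  hence fin: "finite ((\<lambda>A. T \<inter> A) ` tower)" using S unfolding good_def by simp
  have diff: "x - y \<in> T" if xy: "x \<in> T" "y \<in> T" for x y
  proof -
    obtain a where "a \<in> S b \<inter> B" "x = p *s a" using xy(1) T_def by blast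
    moreover obtain c where "c \<in> S b \<inter> B" "y = p *s c" using xy(2) T_def by blast
    ultimately have "a - c \<in> S b \<inter> B" "x - y = p *s (a - c)"
      using grading_diff[OF g] subspace_diff[OF subB] by (auto simp: scale_right_diff_distrib)
    thus ?thesis unfolding T_def by blast
  qed
  have "0 \<in> S b \<inter> B" using grading_zero[OF g] subspace_0[OF subB] by blast
  hence ne: "T \<noteq> {}" unfolding T_def by blast
  have "s \<in> W" "T \<subseteq> W" using SW subset_total[OF g] s TS by blast+
  then obtain t where t: "t \<in> T" "\<And>A s'. A \<in> tower \<Longrightarrow> s' \<in> T \<Longrightarrow> s + s' \<in> A \<Longrightarrow> s + t \<in> A"
    using coset_max[OF diff ne fin] by metis
  obtain a where a: "a \<in> S b" "a \<in> B" "t = p *s a" using t(1) T_def by blast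
  have "s + t \<in> S (b \<noteq> e)" using grading_add[OF g s] t TS by blast
  moreover have "s + t \<in> scale p ` B"
  proof -
    obtain b0 where "b0 \<in> B" "s = p *s b0" using B by blast
    hence "b0 + a \<in> B" "s + t = p *s (b0 + a)"
      using a subspace_add[OF subB] by (auto simp: scale_right_distrib)
    thus ?thesis by blast
  qed
  moreover have "s + t \<in> A" if c: "c \<in> S b" "c \<in> B" and A: "A \<in> tower" "s + t + p *s c \<in> A" for c A
  proof -
    have "a + c \<in> S b \<inter> B" using a c grading_add[OF g] subspace_add[OF subB] by blast
    hence "p *s (a + c) \<in> T" unfolding T_def by blast
    moreover have "s + p *s (a + c) \<in> A" using A a by (simp add: scale_right_distrib add.assoc)
    ultimately show ?thesis using t A by blast
  qed
  ultimately obtain x where x: "x \<in> B" "p *s x = s + t" "proper S x"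
    using lift_maximal[OF S _ B(1)] by metis
  show thesis
  proof (cases "x \<in> total S")
    case True
    \<comment> \<open>As \<open>s + t\<close> is homogeneous, the component of \<open>x\<close> of
      degree \<open>b\<close> is a preimage too.\<close>
    then obtain x1 x0 where xx: "x1 \<in> S b" "x0 \<in> S (\<not> b)" "x = x1 + x0" by (rule totalE)
    have "x1 \<in> B" using good_components[OF S B(1) xx(1,2)] xx x by blast
    moreover have "p *s x1 = s + t"
    proof (rule grading_unique[OF g])
      show "p *s x1 \<in> S (b \<noteq> e)" using grading_scale[OF g p_homogeneous xx(1)] .
      show "p *s x0 \<in> S (\<not> (b \<noteq> e))" by (rule grading_scale_eq[OF g p_homogeneous xx(2)]) auto
      show "p *s x1 + p *s x0 = (s + t) + 0" using x xx by (simp add: scale_right_distrib)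
    qed (use \<open>s + t \<in> S (b \<noteq> e)\<close> grading_zero[OF g] in auto)
    ultimately have "x1 - a \<in> S b" "x1 - a \<in> B" "p *s (x1 - a) = s"
      using a xx grading_diff[OF g] subspace_diff[OF subB] by (auto simp: scale_right_diff_distrib)
    moreover have "\<exists>t\<in>total S. \<exists>f. y - t \<in> B \<and> p *s y = p *s t + f *s s" if "y \<in> total S" for y
    proof (intro bexI exI conjI)
      show "y - y \<in> B" using subspace_0[OF subB] by simp
      show "p *s y = p *s y + 0 *s s" by simp
    qed (rule that)
    ultimately show thesis using that[OF S order_refl] by blast
  next
    case False
    let ?S = "adjoin S b x"
    have xW: "x \<in> W" using x tower_subset B by blast
    have "p *s x \<in> S (b \<noteq> e)" using x \<open>s + t \<in> S (b \<noteq> e)\<close> by simp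
    hence S': "good ?S" using good_adjoin[OF S xW False _ x(3)] by blast
    show thesis
    proof (rule that[OF S' subset_adjoin])
      show "x - a \<in> ?S b"
        using grading_diff[OF good_grading[OF S'] mem_adjoin[OF g]] subset_adjoin a by blast
      show "x - a \<in> B" using x a subspace_diff[OF subB] by blast
      show "p *s (x - a) = s" using x a by (simp add: scale_right_diff_distrib)
      fix y assume "y \<in> total ?S"
      then obtain t0 f where y: "t0 \<in> total S" "y = t0 + f *s x" using total_adjoin[OF g] by blast
      show "\<exists>t\<in>total S. \<exists>f. y - t \<in> B \<and> p *s y = p *s t + f *s s"
      proof (intro bexI exI conjI)
        show "t0 + f *s a \<in> total S"
          using y a subset_total[OF g] subspace_add[OF subspace_total[OF g]] total_scale[OF g] by blast
        have "y - (t0 + f *s a) = f *s (x - a)" using y by (simp add: scale_right_diff_distrib)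
        thus "y - (t0 + f *s a) \<in> B"
          using x a subspace_diff[OF subB] subspace_scale[OF subB] by metis
        have "p *s y = p *s t0 + f *s (p *s x)"
          using y by (simp add: scale_right_distrib mult.commute)
        also have "\<dots> = p *s (t0 + f *s a) + f *s s"
          using x a by (simp add: scale_right_distrib mult.commute)
        finally show "p *s y = p *s (t0 + f *s a) + f *s s" .
      qed
    qed
  qed
qed


section \<open>Capturing arbitrary vectors\<close>

text \<open>
  While \<open>total S\<close> grows, the submodule \<open>p (total S)\<close> and hence the finite set of its heights does not
  change. Each step raises the largest height in the coset \<open>z + total S\<close>, and it can only fail to be the
  last one if the successor of that height occurs in \<open>p (total S)\<close>.
\<close>

lemma adjoin_socle:
  assumes "good S" "z \<in> W" "p *s z = 0"
  shows "\<exists>S'. good S' \<and> (\<forall>c. S c \<subseteq> S' c) \<and> z \<in> total S'"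
proof -
  \<comment> \<open>\<open>A\<close> is a height reached in the coset of \<open>z\<close>; the
    measure counts the traces that members from the successor of \<open>A\<close> on leave on
    \<open>p (total S)\<close>.\<close>
  define m where "m S A = card ((\<lambda>D. scale p ` total S \<inter> D) ` {D \<in> tower. D \<subseteq> scale p ` A})"
    for S :: "bool \<Rightarrow> 'v set" and A
  have fin: "finite ((\<lambda>D. scale p ` total S \<inter> D) ` {D \<in> tower. D \<subseteq> X})" if "good S" for S X
  proof -
    have "scale p ` total S \<subseteq> total S" using total_scale[OF good_grading[OF that]] by blast
    hence "(\<lambda>D. scale p ` total S \<inter> D) ` {D \<in> tower. D \<subseteq> X}
        \<subseteq> (\<lambda>Y. scale p ` total S \<inter> Y) ` (\<lambda>D. total S \<inter> D) ` tower"
      by (auto simp: image_image intro!: image_eqI)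
    thus ?thesis using that unfolding good_def by (meson finite_imageI finite_subset)
  qed
  have main: "\<exists>S'. good S' \<and> (\<forall>c. S c \<subseteq> S' c) \<and> z \<in> total S'"
    if "good S" "s \<in> total S" "A \<in> tower" "z + s \<in> A" for S s A
    using that
  proof (induction "m S A" arbitrary: S s A rule: less_induct)
    case less
    note S = less.prems(1)
    note g = good_grading[OF S]
    note subS = subspace_total[OF g]
    have SW: "total S \<subseteq> W" using S unfolding good_def by blast
    have "finite ((\<lambda>A. total S \<inter> A) ` tower)" using S unfolding good_def by blast
    moreover have "x - y \<in> total S" if "x \<in> total S" "y \<in> total S" for x y
      using subspace_diff[OF subS] that by blast
    moreover have "total S \<noteq> {}" using less.prems(2) by blast
    ultimately obtain r where r: "r \<in> total S"
        "\<And>A s'. A \<in> tower \<Longrightarrow> s' \<in> total S \<Longrightarrow> z + s' \<in> A \<Longrightarrow> z + r \<in> A"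
      using coset_max[of "total S" z] SW \<open>z \<in> W\<close> by metis
    define B where "B = \<Inter>{D \<in> tower. z + r \<in> D}"
    have BA: "B \<subseteq> A" unfolding B_def using r less.prems by blast
    have B: "B \<in> tower" unfolding B_def by (rule tower_Inter) (use r less.prems in blast)+
    have yB: "z + r \<in> B" unfolding B_def by blast
    have B_least: "B \<subseteq> D" if "D \<in> tower" "s' \<in> total S" "z + s' \<in> D" for D s'
      unfolding B_def using r that by blast
    note subB = tower_subspace[OF B]
    have pB: "scale p ` B \<in> tower" using tower.mult B by blast
    have ppB: "scale p ` scale p ` B \<in> tower" using tower.mult pB by blast
    obtain a1 a0 where a: "a1 \<in> S True" "a0 \<in> S (\<not> True)" "r = a1 + a0" using r(1) by (rule totalE)
    have pa1: "p *s a1 \<in> S (True \<noteq> e)" using grading_scale[OF g p_homogeneous a(1)] .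
    have pa0: "p *s a0 \<in> S (False \<noteq> e)" using grading_scale[OF g p_homogeneous, of a0 False] a(2) by simp
    have pa0': "p *s a0 \<in> S (\<not> (True \<noteq> e))" using pa0 by simp
    have "p *s (z + r) = p *s a1 + p *s a0"
      using a(3) \<open>p *s z = 0\<close> by (simp add: scale_right_distrib)
    hence "p *s a1 + p *s a0 \<in> scale p ` B" using yB by (metis image_eqI)
    from good_components[OF S pB pa1 pa0' this]
    have pB1: "p *s a1 \<in> scale p ` B" and pB0: "p *s a0 \<in> scale p ` B" .
    \<comment> \<open>The preimages of \<open>p a1\<close> and \<open>p a0\<close> should lie as
      high as possible: in \<open>p B\<close> if all vectors of \<open>p (total S)\<close> in
      \<open>p B\<close> even lie in \<open>p (p B)\<close>, and in \<open>B\<close>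
      otherwise.\<close>
    define C where "C = (if scale p ` total S \<inter> scale p ` B \<subseteq> scale p ` scale p ` B then scale p ` B else B)"
    have C: "C \<in> tower" "C \<subseteq> B" unfolding C_def using B pB tower_mult_subset by auto
    note subC = tower_subspace[OF C(1)]
    have aS: "a1 \<in> total S" "a0 \<in> total S" using a subset_total[OF g] by blast+
    hence paC: "p *s a1 \<in> scale p ` C" "p *s a0 \<in> scale p ` C"
      unfolding C_def using pB1 pB0 by auto
    obtain S1 x1 where 1: "good S1" "\<And>c. S c \<subseteq> S1 c" "x1 \<in> S1 True" "x1 \<in> C" "p *s x1 = p *s a1"
      and r1: "\<And>y. y \<in> total S1 \<Longrightarrow> \<exists>t\<in>total S. \<exists>f. y - t \<in> C \<and> p *s y = p *s t + f *s (p *s a1)"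
      by (rule lift_homogeneous[OF S pa1 C(1) paC(1)]) (rule that)
    have pa0_1: "p *s a0 \<in> S1 (False \<noteq> e)" using pa0 1 by blast
    obtain S2 x0 where 2: "good S2" "\<And>c. S1 c \<subseteq> S2 c" "x0 \<in> S2 False" "x0 \<in> C" "p *s x0 = p *s a0"
      and r2: "\<And>y. y \<in> total S2 \<Longrightarrow> \<exists>t\<in>total S1. \<exists>f. y - t \<in> C \<and> p *s y = p *s t + f *s (p *s a0)"
      by (rule lift_homogeneous[OF 1(1) pa0_1 C(1) paC(2)]) (rule that)
    note g2 = good_grading[OF 2(1)]
    note sub2 = subspace_total[OF g2]
    have S2: "S c \<subseteq> S2 c" for c using 1 2 by blast
    hence SS2: "total S \<subseteq> total S2" using total_mono by blast
    have SS1: "total S \<subseteq> total S1" using total_mono 1 by blast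
    have close: "\<exists>t\<in>total S. y - t \<in> C \<and> p *s y \<in> scale p ` total S" if y: "y \<in> total S2" for y
    proof -
      obtain t1 f1 where t1: "t1 \<in> total S1" "y - t1 \<in> C" "p *s y = p *s t1 + f1 *s (p *s a0)"
        using r2[OF y] by blast
      obtain t0 f0 where t0: "t0 \<in> total S" "t1 - t0 \<in> C" "p *s t1 = p *s t0 + f0 *s (p *s a1)"
        using r1[OF t1(1)] by blast
      have "y - t0 = (y - t1) + (t1 - t0)" by simp
      hence "y - t0 \<in> C" using subspace_add[OF subC t1(2) t0(2)] by simp
      moreover have "p *s y = p *s (t0 + f0 *s a1 + f1 *s a0)"
        using t1 t0 by (simp add: scale_right_distrib mult.commute)
      moreover have "t0 + f0 *s a1 + f1 *s a0 \<in> total S"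
        using t0 aS subspace_add[OF subS] subspace_scale[OF subS] by blast
      ultimately show ?thesis using t0 by (metis image_eqI)
    qed
    \<comment> \<open>Subtracting the homogeneous preimages keeps the vector in \<open>B\<close> and
      makes \<open>p\<close> kill it. As \<open>0\<close> has every degree, \<open>z + t\<close> may
      be adjoined in either degree once it is proper.\<close>
    define t where "t = r - x1 - x0"
    have "r \<in> total S2" "x1 \<in> total S2" "x0 \<in> total S2"
      using r(1) SS2 1(3) 2(2)[of True] 2(3) subset_total[OF g2] by blast+
    hence t: "t \<in> total S2" unfolding t_def by (intro subspace_diff[OF sub2])
    have zt: "z + t = (z + r) - x1 - x0" unfolding t_def by simp
    have ztB: "z + t \<in> B" unfolding zt using yB 1(4) 2(4) C(2) by (intro subspace_diff[OF subB]) blast+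
    have pzt: "p *s (z + t) = 0"
      unfolding t_def using a(3) 1(5) 2(5) \<open>p *s z = 0\<close> by (simp add: scale_right_distrib scale_right_diff_distrib)
    have finish: ?case if "good S'" "\<And>c. S2 c \<subseteq> S' c" "z + t \<in> total S'" for S'
    proof -
      have "total S2 \<subseteq> total S'" using total_mono that by blast
      hence "(z + t) - t \<in> total S'"
        using t that subspace_diff[OF subspace_total[OF good_grading[OF that(1)]]] by blast
      thus ?case using that S2 by (metis add_diff_cancel_right' subset_trans)
    qed
    consider "z + t \<in> total S2" | "z + t \<notin> total S2" "proper S2 (z + t)"
      | D q where "D \<in> tower" "q \<in> total S2" "z + t + q \<in> D" "z + t \<notin> D"
      unfolding proper_def by blast
    thus ?case
    proof cases
      case 1
      thus ?thesis using finish[OF 2(1)] by blast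
    next
      case 2
      have "z + t \<in> W" using ztB tower_subset B by blast
      moreover have "p *s (z + t) \<in> S2 (True \<noteq> e)" using pzt grading_zero[OF g2] by simp
      ultimately have "good (adjoin S2 True (z + t))"
        using good_adjoin[OF \<open>good S2\<close> _ 2(1) _ 2(2)] by blast
      thus ?thesis
        using finish subset_adjoin mem_adjoin[OF g2] subset_total[OF good_grading] by blast
    next
      case 3
      have "\<not> B \<subseteq> D" using 3 ztB by blast
      hence DpB: "D \<subseteq> scale p ` B" using tower_compare_mult[OF 3(1) B] by blast
      show ?thesis
      proof (cases "scale p ` total S \<inter> scale p ` B \<subseteq> scale p ` scale p ` B")
        case True
        hence Ceq: "C = scale p ` B" by (simp add: C_def)
        \<comment> \<open>Modulo \<open>C = p B\<close> the new vectors come from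
          \<open>total S\<close>, so a vector beyond \<open>B\<close> in the new coset gives one in
          the old coset, where \<open>B\<close> was maximal.\<close>
        obtain q0 where q0: "q0 \<in> total S" "q - q0 \<in> C" using close[OF 3(2)] by blast
        have "z + t + q \<in> C" using 3 DpB Ceq by blast
        from subspace_diff[OF subC subspace_add[OF subC subspace_add[OF subC this 1(4)] 2(4)] q0(2)]
        have "(z + t + q) + x1 + x0 - (q - q0) \<in> C" .
        moreover have "(z + t + q) + x1 + x0 - (q - q0) = z + (r + q0)" by (simp add: zt)
        moreover have "r + q0 \<in> total S" using r q0 subspace_add[OF subS] by blast
        ultimately have "B \<subseteq> C" using B_least C(1) by metis
        hence "B \<subseteq> D" using tower_stable_least[OF B] Ceq 3(1) by blast
        thus ?thesis using \<open>\<not> B \<subseteq> D\<close> by blast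
      next
        case False
        \<comment> \<open>The recursion continues with the higher vector in \<open>D\<close>. The
          trace of \<open>p B\<close> is no longer counted: it is not inside \<open>p (p B)\<close>,
          which contains \<open>p D\<close>.\<close>
        have "scale p ` total S2 = scale p ` total S" using close SS2 by blast
        hence "m S2 D = card ((\<lambda>E. scale p ` total S \<inter> E) ` {E \<in> tower. E \<subseteq> scale p ` D})"
          by (simp add: m_def)
        also have "\<dots> < m S A" unfolding m_def
        proof (rule psubset_card_mono[OF fin[OF S]], rule psubsetI)
          have DpA: "D \<subseteq> A" using DpB BA tower_mult_subset[OF B] by blast
          show "(\<lambda>E. scale p ` total S \<inter> E) ` {E \<in> tower. E \<subseteq> scale p ` D}
              \<subseteq> (\<lambda>E. scale p ` total S \<inter> E) ` {E \<in> tower. E \<subseteq> scale p ` A}"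
            by (rule image_mono) (use image_mono[OF DpA, of "scale p"] in blast)
          have "scale p ` total S \<inter> scale p ` B
              \<notin> (\<lambda>E. scale p ` total S \<inter> E) ` {E \<in> tower. E \<subseteq> scale p ` D}"
          proof
            assume "scale p ` total S \<inter> scale p ` B
              \<in> (\<lambda>E. scale p ` total S \<inter> E) ` {E \<in> tower. E \<subseteq> scale p ` D}"
            then obtain E where "E \<subseteq> scale p ` D"
              "scale p ` total S \<inter> scale p ` B = scale p ` total S \<inter> E" by blast
            moreover have "scale p ` D \<subseteq> scale p ` scale p ` B" using DpB by (rule image_mono)
            ultimately show False using False by blast
          qed
          moreover have "scale p ` total S \<inter> scale p ` B
              \<in> (\<lambda>E. scale p ` total S \<inter> E) ` {E \<in> tower. E \<subseteq> scale p ` A}"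
            using pB image_mono[OF BA, of "scale p"] by blast
          ultimately show "(\<lambda>E. scale p ` total S \<inter> E) ` {E \<in> tower. E \<subseteq> scale p ` D}
              \<noteq> (\<lambda>E. scale p ` total S \<inter> E) ` {E \<in> tower. E \<subseteq> scale p ` A}" by metis
        qed
        finally have "\<exists>S'. good S' \<and> (\<forall>c. S2 c \<subseteq> S' c) \<and> z \<in> total S'"
          using less.hyps[of S2 D "t + q"] 2(1) 3 subspace_add[OF sub2 t 3(2)]
          by (simp add: add.assoc)
        thus ?thesis using S2 by blast
      qed
    qed
  qed
  show ?thesis
    using main[OF assms(1) subspace_0[OF subspace_total[OF good_grading[OF assms(1)]]] tower.top]
      assms by simp
qed

text \<open>The components of \<open>p v\<close> inherit divisibility by \<open>p\<close>, so they
  have homogeneous preimages in \<open>W\<close>; subtracting these from \<open>v\<close> leaves a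
  vector killed by \<open>p\<close>.\<close>

lemma adjoin_divisor:
  assumes S: "good S" and v: "v \<in> W" "p *s v \<in> total S"
  shows "\<exists>S'. good S' \<and> (\<forall>c. S c \<subseteq> S' c) \<and> v \<in> total S'"
proof -
  note g = good_grading[OF S]
  obtain s1 s0 where s: "s1 \<in> S (True \<noteq> e)" "s0 \<in> S (\<not> (True \<noteq> e))" "p *s v = s1 + s0"
    using v(2) by (rule totalE)
  have "p *s v \<in> scale p ` W" using v by blast
  hence W: "s1 \<in> scale p ` W" "s0 \<in> scale p ` W"
    using good_components[OF S tower.mult[OF tower.top] s(1,2)] s(3) by auto
  obtain S1 x1 where 1: "good S1" "\<And>c. S c \<subseteq> S1 c" "x1 \<in> S1 True" "x1 \<in> W" "p *s x1 = s1"
    by (rule lift_homogeneous[OF S s(1) tower.top W(1)]) (rule that)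
  have s0_1: "s0 \<in> S1 (False \<noteq> e)" using s(2) 1(2) by auto
  obtain S2 x0 where 2: "good S2" "\<And>c. S1 c \<subseteq> S2 c" "x0 \<in> S2 False" "x0 \<in> W" "p *s x0 = s0"
    by (rule lift_homogeneous[OF 1(1) s0_1 tower.top W(2)]) (rule that)
  have "v - (x1 + x0) \<in> W" using v 1 2 subspace_diff[OF subspace_W] subspace_add[OF subspace_W] by blast
  moreover have "p *s (v - (x1 + x0)) = 0"
    using s 1 2 by (simp add: scale_right_distrib scale_right_diff_distrib)
  ultimately obtain S3 where 3: "good S3" "\<And>c. S2 c \<subseteq> S3 c" "v - (x1 + x0) \<in> total S3"
    using adjoin_socle[OF 2(1)] by blast
  note g3 = good_grading[OF 3(1)]
  have "x1 \<in> S3 True" "x0 \<in> S3 (\<not> True)" using 1(3) 2(3) 2(2)[of True] 3(2)[of True] 3(2)[of False] by auto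
  hence "x1 + x0 \<in> total S3" using totalI by metis
  hence "(v - (x1 + x0)) + (x1 + x0) \<in> total S3" using 3 subspace_add[OF subspace_total[OF g3]] by blast
  thus ?thesis using 1 2 3 by (metis diff_add_cancel subset_trans)
qed

lemma adjoin_vector:
  assumes "good S" "v \<in> W"
  shows "\<exists>S'. good S' \<and> (\<forall>c. S c \<subseteq> S' c) \<and> v \<in> total S'"
proof -
  obtain n where "p ^ n *s v = 0" using W_primary assms by blast
  thus ?thesis using assms(2)
  proof (induction n arbitrary: v)
    case 0
    thus ?case using assms(1) subspace_0[OF subspace_total[OF good_grading]] by force
  next
    case (Suc n)
    have "p ^ n *s (p *s v) = 0" using Suc.prems by (simp add: mult.commute)
    moreover have "p *s v \<in> W" using Suc.prems subspace_scale[OF subspace_W] by blast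
    ultimately obtain S1 where 1: "good S1" "\<And>c. S c \<subseteq> S1 c" "p *s v \<in> total S1"
      using Suc.IH by blast
    obtain S2 where "good S2" "\<And>c. S1 c \<subseteq> S2 c" "v \<in> total S2"
      using adjoin_divisor[OF 1(1) Suc.prems(2) 1(3)] by blast
    thus ?case using 1 by blast
  qed
qed

theorem exists_grading:
  assumes "countable X" "X \<subseteq> W" "W \<subseteq> span X"
  shows "\<exists>G. grading G \<and> total G = W"
proof -
  \<comment> \<open>Inserting \<open>0\<close> keeps the enumeration meaningful for empty
    \<open>X\<close>; a finite set is enumerated with repetitions.\<close>
  define v where "v = from_nat_into (insert 0 X)"
  have range_v: "range v = insert 0 X" unfolding v_def using assms(1) by (intro range_from_nat_into) auto
  have "range v \<subseteq> W" using range_v assms(2) subspace_0[OF subspace_W] by simp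
  hence vW: "v n \<in> W" for n by blast
  have zero: "total (\<lambda>b. {0}) = {0}" unfolding total_def by simp
  have good0: "good (\<lambda>b. {0})"
    unfolding good_def grading_def zero using subspace_0[OF subspace_W] subspace_0[OF tower_subspace]
    by (auto intro: finite_subset[of _ "{{0}}"])
  obtain S where S: "\<And>n. good (S n)" "\<And>n. (\<forall>c. S n c \<subseteq> S (Suc n) c) \<and> v n \<in> total (S (Suc n))"
  proof -
    have "\<exists>S. \<forall>n. good (S n) \<and> ((\<forall>c. S n c \<subseteq> S (Suc n) c) \<and> v n \<in> total (S (Suc n)))"
    proof (rule dependent_nat_choice)
      show "\<exists>x. good x" using good0 by blast
      show "\<exists>y. good y \<and> (\<forall>c. x c \<subseteq> y c) \<and> v n \<in> total y" if "good x" for x n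
        using adjoin_vector[OF that vW] by blast
    qed
    thus thesis using that by blast
  qed
  have mono: "S m c \<subseteq> S n c" if "m \<le> n" for m n c
    using lift_Suc_mono_le[of "\<lambda>n. S n c"] S(2) that by blast
  define G where "G b = (\<Union>n. S n b)" for b
  have common: "\<exists>n. x \<in> S n b \<and> y \<in> S n c" if "x \<in> G b" "y \<in> G c" for x y b c
  proof -
    obtain i j where "x \<in> S i b" "y \<in> S j c" using \<open>x \<in> G b\<close> \<open>y \<in> G c\<close> unfolding G_def by blast
    hence "x \<in> S (max i j) b" "y \<in> S (max i j) c"
      using mono[OF max.cobounded1] mono[OF max.cobounded2] by blast+
    thus ?thesis by blast
  qed
  have SG: "S n b \<subseteq> G b" for n b unfolding G_def by blast
  have G: "grading G" unfolding grading_def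
  proof (intro conjI allI ballI)
    show "0 \<in> G b" for b using SG grading_zero[OF good_grading[OF S(1)]] by blast
    show "x + y \<in> G b" if "x \<in> G b" "y \<in> G b" for b x y
      using common[OF that] SG grading_add[OF good_grading[OF S(1)]] by blast
    show "f *s x \<in> G (b \<noteq> d)" if f: "f \<in> H d" and x: "x \<in> G b" for b d f x
    proof -
      obtain n where "x \<in> S n b" using x unfolding G_def by blast
      thus ?thesis using SG grading_scale[OF good_grading[OF S(1)] f] by blast
    qed
    show "G True \<inter> G False \<subseteq> {0}"
    proof
      fix x assume "x \<in> G True \<inter> G False"
      then obtain n where "x \<in> S n True" "x \<in> S n (\<not> True)" using common[of x True x False] by auto
      thus "x \<in> {0}" using grading_disjoint[OF good_grading[OF S(1)]] by blast
    qed
  qed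
  have "total G \<subseteq> W"
  proof
    fix x assume "x \<in> total G"
    then obtain a b where ab: "a \<in> G True" "b \<in> G (\<not> True)" "x = a + b" by (rule totalE)
    then obtain n where "a \<in> S n True" "b \<in> S n (\<not> True)" using common by blast
    hence "x \<in> total (S n)" using ab totalI by metis
    thus "x \<in> W" using S(1) unfolding good_def by blast
  qed
  moreover have "W \<subseteq> total G"
  proof -
    have "X \<subseteq> total G"
    proof
      fix x assume "x \<in> X"
      hence "x \<in> range v" using range_v by simp
      then obtain n where "x = v n" by blast
      thus "x \<in> total G" using S(2)[of n] total_mono[of "S (Suc n)" G, OF SG] by blast
    qed
    thus ?thesis using assms(3) span_minimal[OF _ subspace_total[OF G]] by blast
  qed
  ultimately show ?thesis using G by blast
qed

end

section \<open>Polynomials\<close>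

text \<open>Coprimality as a Bezout relation, the form that can be applied to a vector in order to
  split kernels.\<close>

definition comaximal :: "'r::comm_ring_1 \<Rightarrow> 'r \<Rightarrow> bool" where
  "comaximal f g \<longleftrightarrow> (\<exists>a b. a * f + b * g = 1)"

lemma comaximal_commute: "comaximal f g \<longleftrightarrow> comaximal g f"
  unfolding comaximal_def by (metis add.commute)

lemma comaximal_one: "comaximal f 1"
  unfolding comaximal_def by (intro exI[of _ 0] exI[of _ 1]) simp

lemma comaximal_mult:
  assumes "comaximal f g" "comaximal f h" shows "comaximal f (g * h)"
proof -
  obtain a b c d where 1: "a * f + b * g = 1" "c * f + d * h = 1"
    using assms unfolding comaximal_def by blast
  have "(a * c * f + a * d * h + b * g * c) * f + (b * d) * (g * h) = (a * f + b * g) * (c * f + d * h)"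
    by (simp add: algebra_simps)
  thus ?thesis unfolding comaximal_def 1 by (metis mult_1)
qed

lemma comaximal_prod:
  "(\<And>i. i \<in> J \<Longrightarrow> comaximal f (g i)) \<Longrightarrow> comaximal f (prod g J)"
  by (induction J rule: infinite_finite_induct) (auto intro: comaximal_one comaximal_mult)

lemma comaximal_power: "comaximal f g \<Longrightarrow> comaximal f (g ^ n)"
  by (induction n) (auto intro: comaximal_one comaximal_mult)

lemma comaximal_powers: "comaximal f g \<Longrightarrow> comaximal (f ^ m) (g ^ n)"
  using comaximal_power comaximal_commute by metis

lemma comaximal_mult_dvd:
  assumes "comaximal f g" "f dvd h" "g dvd h" shows "f * g dvd h"
proof -
  obtain a b where ab: "a * f + b * g = 1" using assms(1) unfolding comaximal_def by blast
  obtain k where "h = f * k" using assms(2) by (rule dvdE)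
  moreover obtain l where "h = g * l" using assms(3) by (rule dvdE)
  ultimately have "f * g dvd a * f * h" "f * g dvd b * g * h"
    by (metis dvd_triv_left dvd_triv_right mult.assoc mult.commute mult_dvd_mono)+
  hence "f * g dvd (a * f + b * g) * h" unfolding distrib_right by (rule dvd_add)
  thus ?thesis unfolding ab by simp
qed

lemma poly_bezout:
  fixes f g :: "'a::field poly"
  shows "\<exists>d a b. d = a * f + b * g \<and> d dvd f \<and> d dvd g"
\<comment> \<open>Zero and the nonzero constants share degree 0; the measure separates them, so that
  the last remainder still counts as smaller.\<close>
proof (induction "if g = 0 then 0 else Suc (degree g)" arbitrary: f g rule: less_induct)
  case less
  show ?case
  proof (cases "g = 0")
    case True
    thus ?thesis by (intro exI[of _ f] exI[of _ 1] exI[of _ 0]) simp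
  next
    case False
    have "f mod g = 0 \<or> degree (f mod g) < degree g" using degree_mod_less False by blast
    hence "(if f mod g = 0 then 0 else Suc (degree (f mod g))) < (if g = 0 then 0 else Suc (degree g))"
      using False by auto
    then obtain d a b where d: "d = a * g + b * (f mod g)" "d dvd g" "d dvd f mod g"
      using less by blast
    have "b * f = b * (f div g * g + f mod g)" by simp
    hence "d = b * f + (a - b * (f div g)) * g" using d(1) by (simp only: algebra_simps)
    moreover have "d dvd f" using d(2,3) dvd_mod_iff by blast
    ultimately show ?thesis using d(2) by blast
  qed
qed

lemma comaximal_poly_iff:
  fixes f g :: "'a::field poly"
  assumes "g \<noteq> 0" "\<And>d. d dvd f \<Longrightarrow> d dvd g \<Longrightarrow> degree d = 0"
  shows "comaximal f g"
proof -
  obtain d a b where d: "d = a * f + b * g" "d dvd f" "d dvd g" using poly_bezout by blast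
  obtain c where c: "d = [:c:]" using assms(2)[OF d(2,3)] degree_eq_zeroE by blast
  have "c \<noteq> 0" using c d assms(1) by auto
  hence "[:1 / c:] * d = 1" using c by (simp add: one_pCons)
  hence "([:1 / c:] * a) * f + ([:1 / c:] * b) * g = 1" unfolding d(1) by (simp only: algebra_simps)
  thus ?thesis unfolding comaximal_def by blast
qed

lemma dvd_degree_eq_imp_dvd:
  fixes d p :: "'a::field poly"
  assumes "d dvd p" "p \<noteq> 0" "degree p \<le> degree d" shows "p dvd d"
proof -
  obtain k where k: "p = d * k" using assms(1) by (rule dvdE)
  hence "d \<noteq> 0" "k \<noteq> 0" using assms by auto
  hence "degree k = 0" using k assms(3) degree_mult_eq by fastforce
  then obtain c where "k = [:c:]" using degree_eq_zeroE by blast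
  hence "p = smult c d" "c \<noteq> 0" using k \<open>k \<noteq> 0\<close> by auto
  thus ?thesis by (simp add: smult_dvd_iff)
qed

section \<open>The parity grading of the polynomial ring\<close>

definition parity_polys :: "bool \<Rightarrow> 'a::field poly set" where
  "parity_polys d = {f. \<forall>i. coeff f i \<noteq> 0 \<longrightarrow> odd i = d}"

lemma parity_pCons: "pCons a f \<in> parity_polys d \<longleftrightarrow> (a = 0 \<or> \<not> d) \<and> f \<in> parity_polys (\<not> d)"
proof
  assume l: "pCons a f \<in> parity_polys d"
  have "coeff f i \<noteq> 0 \<Longrightarrow> odd i = (\<not> d)" for i
    using l[unfolded parity_polys_def, simplified, rule_format, of "Suc i"] by auto
  moreover have "a = 0 \<or> \<not> d" using l[unfolded parity_polys_def, simplified, rule_format, of 0] by auto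
  ultimately show "(a = 0 \<or> \<not> d) \<and> f \<in> parity_polys (\<not> d)" unfolding parity_polys_def by blast
next
  assume "(a = 0 \<or> \<not> d) \<and> f \<in> parity_polys (\<not> d)"
  thus "pCons a f \<in> parity_polys d"
    unfolding parity_polys_def by (auto simp: coeff_pCons split: nat.splits)
qed

lemma parity_zero: "0 \<in> parity_polys d"
  by (simp add: parity_polys_def)

lemma parity_const: "[:c:] \<in> parity_polys False"
  by (simp add: parity_pCons parity_zero)

lemma parity_X: "[:0, 1:] \<in> parity_polys True"
  by (simp add: parity_pCons parity_zero)

lemma parity_decomp: "\<exists>f0\<in>parity_polys False. \<exists>f1\<in>parity_polys True. f = f0 + f1"
proof (induction f)
  case 0
  show ?case using parity_zero by force
next
  case (pCons a f)
  then obtain f0 f1 where "f0 \<in> parity_polys False" "f1 \<in> parity_polys True" "f = f0 + f1" by blast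
  hence "pCons a f1 \<in> parity_polys False" "pCons 0 f0 \<in> parity_polys True"
    "pCons a f = pCons a f1 + pCons 0 f0" by (simp_all add: parity_pCons add.commute)
  thus ?case by blast
qed

lemma parity_mult:
  assumes "f \<in> parity_polys c" "g \<in> parity_polys d" shows "f * g \<in> parity_polys (c \<noteq> d)"
  unfolding parity_polys_def
proof (intro CollectI allI impI)
  fix i assume "coeff (f * g) i \<noteq> 0"
  then obtain j where j: "j \<le> i" "coeff f j * coeff g (i - j) \<noteq> 0"
    unfolding coeff_mult by (metis (no_types, lifting) atMost_iff sum.not_neutral_contains_not_neutral)
  hence "odd j = c" "odd (i - j) = d" using assms unfolding parity_polys_def by auto
  thus "odd i = (c \<noteq> d)" using j(1) by auto
qed

context graded_module
begin

text \<open>The pieces are added degree by degree. Independence of the pieces reduces a coincidence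
  of degrees to a single piece, where the grading excludes it.\<close>

lemma combine_gradings:
  fixes G :: "'i \<Rightarrow> bool \<Rightarrow> 'v set"
  assumes G: "\<And>i. i \<in> I \<Longrightarrow> grading (G i)"
    and indep: "\<And>J x i. finite J \<Longrightarrow> J \<subseteq> I \<Longrightarrow> (\<And>i. i \<in> J \<Longrightarrow> x i \<in> total (G i)) \<Longrightarrow>
      sum x J = 0 \<Longrightarrow> i \<in> J \<Longrightarrow> x i = 0"
  shows "\<exists>K. grading K \<and> (\<forall>i\<in>I. total (G i) \<subseteq> total K)"
proof -
  define K where "K b = {sum a J | a J. finite J \<and> J \<subseteq> I \<and> (\<forall>i\<in>J. a i \<in> G i b)}" for b
  have KI: "sum a J \<in> K b" if "finite J" "J \<subseteq> I" "\<And>i. i \<in> J \<Longrightarrow> a i \<in> G i b" for a J b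
    unfolding K_def using that by blast
  have common: "\<exists>a c J. finite J \<and> J \<subseteq> I \<and> (\<forall>i\<in>J. a i \<in> G i b \<and> c i \<in> G i d) \<and> x = sum a J \<and> y = sum c J"
    if x: "x \<in> K b" and y: "y \<in> K d" for x y b d
  proof -
    obtain a J where a: "finite J" "J \<subseteq> I" "\<forall>i\<in>J. a i \<in> G i b" "x = sum a J"
      using x unfolding K_def by blast
    obtain c L where c: "finite L" "L \<subseteq> I" "\<forall>i\<in>L. c i \<in> G i d" "y = sum c L"
      using y unfolding K_def by blast
    have "x = (\<Sum>i\<in>J \<union> L. if i \<in> J then a i else 0)"
      unfolding a(4) by (rule sum.mono_neutral_cong_left) (use a c in auto)
    moreover have "y = (\<Sum>i\<in>J \<union> L. if i \<in> L then c i else 0)"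
      unfolding c(4) by (rule sum.mono_neutral_cong_left) (use a c in auto)
    moreover have "\<forall>i\<in>J \<union> L. (if i \<in> J then a i else 0) \<in> G i b \<and> (if i \<in> L then c i else 0) \<in> G i d"
      using a c grading_zero[OF G] by auto
    moreover have "finite (J \<union> L)" "J \<union> L \<subseteq> I" using a(1,2) c(1,2) by auto
    ultimately show ?thesis by (intro exI conjI)
  qed
  have "grading K" unfolding grading_def
  proof (intro conjI allI ballI)
    show "0 \<in> K b" for b using KI[of "{}"] by simp
    show "x + y \<in> K b" if xy: "x \<in> K b" "y \<in> K b" for x y b
    proof -
      obtain a c J where "finite J" "J \<subseteq> I" "\<forall>i\<in>J. a i \<in> G i b \<and> c i \<in> G i b"
        "x = sum a J" "y = sum c J" using common[OF xy] by blast
      thus ?thesis using KI[of J "\<lambda>i. a i + c i" b] grading_add[OF G]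
        by (simp add: sum.distrib subset_iff)
    qed
    show "f *s x \<in> K (b \<noteq> d)" if f: "f \<in> H d" and x: "x \<in> K b" for f x b d
    proof -
      obtain a J where a: "finite J" "J \<subseteq> I" "\<forall>i\<in>J. a i \<in> G i b" "x = sum a J"
        using x unfolding K_def by blast
      have "f *s a i \<in> G i (b \<noteq> d)" if "i \<in> J" for i
        using grading_scale[OF G f] that a by blast
      thus ?thesis using KI[of J "\<lambda>i. f *s a i" "b \<noteq> d"] a by (simp add: scale_sum_right)
    qed
    show "K True \<inter> K False \<subseteq> {0}"
    proof
      fix x assume x: "x \<in> K True \<inter> K False"
      obtain a c J where J: "finite J" "J \<subseteq> I" "\<forall>i\<in>J. a i \<in> G i True \<and> c i \<in> G i False"
        "x = sum a J" "x = sum c J" using common[of x True x False] x by blast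
      have "a i = 0" if i: "i \<in> J" for i
      proof -
        have Gi: "grading (G i)" if "i \<in> J" for i using G J(2) that by blast
        have "a j + - c j \<in> total (G j)" if "j \<in> J" for j
          using totalI[of "a j" "G j" True "- c j"] grading_minus[OF Gi[OF that]] J(3) that by simp
        moreover have "(\<Sum>j\<in>J. a j + - c j) = 0" using J by (simp add: sum_subtractf)
        ultimately have "a i + - c i = 0" using indep[OF J(1,2), of "\<lambda>j. a j + - c j"] i by blast
        hence "a i = c i" by simp
        moreover have "a i \<in> G i True" "c i \<in> G i (\<not> True)" using J(3) i by auto
        ultimately show ?thesis using grading_disjoint[OF Gi[OF i]] by metis
      qed
      thus "x \<in> {0}" using J by simp
    qed
  qed
  moreover have "total (G i) \<subseteq> total K" if i: "i \<in> I" for i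
  proof (rule total_mono)
    show "G i b \<subseteq> K b" for b
    proof
      fix x assume "x \<in> G i b"
      thus "x \<in> K b" using KI[of "{i}" "\<lambda>_. x" b] i by simp
    qed
  qed
  ultimately show ?thesis by blast
qed

end

section \<open>The polynomial module of an endomorphism\<close>

locale poly_module = vector_space scale
  for scale :: "'a::field \<Rightarrow> 'v::ab_group_add \<Rightarrow> 'v" +
  fixes u :: "'v \<Rightarrow> 'v"
  assumes linear_u: "Vector_Spaces.linear scale scale u"
begin

lemma u_add: "u (x + y) = u x + u y"
  and u_scale: "u (scale c x) = scale c (u x)"
  and u_zero: "u 0 = 0"
  and u_minus: "u (- x) = - u x"
  and u_diff: "u (x - y) = u x - u y"
proof -
  interpret u: Vector_Spaces.linear scale scale u by (rule linear_u)
  show "u (x + y) = u x + u y" "u (scale c x) = scale c (u x)" "u 0 = 0" "u (- x) = - u x"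
    "u (x - y) = u x - u y"
    by (simp_all add: u.add u.scale u.neg u.diff)
qed

text \<open>\<open>f(u) x\<close> in Horner form, which matches induction along
  \<open>pCons\<close>.\<close>

definition act :: "'a poly \<Rightarrow> 'v \<Rightarrow> 'v" where
  "act f x = fold_coeffs (\<lambda>a y. scale a x + u y) f 0"

lemma act_zero [simp]: "act 0 x = 0"
  by (simp add: act_def)

lemma act_pCons [simp]: "act (pCons a f) x = scale a x + u (act f x)"
  \<comment> \<open>\<open>pCons 0 0\<close> is the zero polynomial, with no coefficient to fold
    over.\<close>
  by (cases "a = 0 \<and> f = 0") (auto simp: act_def u_zero)

lemma act_add_right: "act f (x + y) = act f x + act f y"
  by (induction f) (simp_all add: u_add scale_right_distrib)

lemma act_add_left: "act (f + g) x = act f x + act g x"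
  by (induction f g rule: poly_induct2) (simp_all add: u_add scale_left_distrib)

lemma act_smult: "act (smult c f) x = scale c (act f x)"
  by (induction f) (simp_all add: u_scale scale_right_distrib)

lemma act_mult: "act (f * g) x = act f (act g x)"
  by (induction f) (simp_all add: act_add_left act_smult)

lemma act_one: "act 1 x = x"
  by (simp add: one_pCons u_zero)

sublocale P: graded_module act parity_polys
proof
  show "act a (x + y) = act a x + act a y" for a x y by (rule act_add_right)
  show "act (a + b) x = act a x + act b x" for a b x by (rule act_add_left)
  show "act a (act b x) = act (a * b) x" for a b x by (simp add: act_mult)
  show "act 1 x = x" for x by (rule act_one)
  show "1 \<in> parity_polys False" by (simp add: parity_polys_def)
  show "f - g \<in> parity_polys d" if "f \<in> parity_polys d" "g \<in> parity_polys d" for f g :: "'a poly" and d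
    using that unfolding parity_polys_def by (auto simp: coeff_diff) (metis diff_0_right diff_self)+
  show "f * g \<in> parity_polys (c \<noteq> d)" if "f \<in> parity_polys c" "g \<in> parity_polys d"
    for f g :: "'a poly" and c d using that by (rule parity_mult)
  show "\<exists>f0\<in>parity_polys False. \<exists>f1\<in>parity_polys True. f = f0 + f1" for f :: "'a poly"
    by (rule parity_decomp)
  show "f = 0" if "f \<in> parity_polys False" "f \<in> parity_polys True" for f :: "'a poly"
    using that unfolding parity_polys_def by (auto simp: poly_eq_iff)
qed

lemma u_eq_act: "u x = act [:0, 1:] x"
  by (simp add: u_zero)

lemma scale_eq_act: "scale c x = act [:c:] x"
  by (simp add: u_zero)

lemma P_subspace_imp: "P.subspace W \<Longrightarrow> subspace W"
  by (rule subspaceI) (simp_all add: P.subspace_0 P.subspace_add P.subspace_scale scale_eq_act del: act_pCons)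

lemma exchange_of_grading:
  assumes G: "P.grading G" and "P.total G = UNIV"
  shows "exchange_property scale u"
  unfolding exchange_property_def splitting_def
proof (intro exI conjI)
  show "subspace (G b)" for b
  proof (rule subspaceI)
    show "scale c x \<in> G b" if "x \<in> G b" for c x
      using P.grading_scale[OF G parity_const that, of c] scale_eq_act[of c x]
      by (simp del: act_pCons)
  qed (use P.grading_zero[OF G] P.grading_add[OF G] in auto)
  thus "subspace (G False)" .
  show "{x + y |x y. x \<in> G True \<and> y \<in> G False} = UNIV"
    using assms(2) unfolding P.total_def .
  show "G True \<inter> G False = {0}" using G P.grading_zero[OF G] unfolding P.grading_def by blast
  have "u x \<in> G (b \<noteq> True)" if "x \<in> G b" for x b
    using P.grading_scale[OF G parity_X that] u_eq_act[of x] by (simp del: act_pCons)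
  from this[of _ True] this[of _ False]
  show "u ` G True \<subseteq> G False" "u ` G False \<subseteq> G True" by auto
qed

text \<open>Scalars and the variable generate the polynomials, so it suffices to know how these two
  act on degrees.\<close>

lemma gradingI:
  assumes "\<And>b. 0 \<in> G b" "\<And>b x y. x \<in> G b \<Longrightarrow> y \<in> G b \<Longrightarrow> x + y \<in> G b"
    and "\<And>b c x. x \<in> G b \<Longrightarrow> scale c x \<in> G b" and "\<And>b x. x \<in> G b \<Longrightarrow> u x \<in> G (\<not> b)"
    and "\<And>x. x \<in> G True \<Longrightarrow> x \<in> G False \<Longrightarrow> x = 0"
  shows "P.grading G"
  unfolding P.grading_def
proof (intro conjI allI ballI)
  fix b d x and f :: "'a poly" assume "f \<in> parity_polys d" "x \<in> G b"
  thus "act f x \<in> G (b \<noteq> d)"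
  proof (induction f arbitrary: d)
    case (pCons a f)
    have f: "a = 0 \<or> \<not> d" "f \<in> parity_polys (\<not> d)" using pCons.prems parity_pCons by blast+
    have "u (act f x) \<in> G (\<not> (b \<noteq> (\<not> d)))" using pCons.IH[OF f(2) pCons.prems(2)] assms(4) by blast
    moreover have "scale a x \<in> G (b \<noteq> d)" using f(1) assms(1,3) pCons.prems(2) by (cases "a = 0") auto
    moreover have "(\<not> (b \<noteq> (\<not> d))) = (b \<noteq> d)" by auto
    ultimately show ?case using assms(2) by simp
  qed (simp add: assms)
qed (use assms in auto)

text \<open>A linear projection onto \<open>W\<close> sends a countable basis to a countable
  spanning set of \<open>W\<close>. It need not commute with \<open>u\<close>, since spanning over
  the field is enough.\<close>

lemma countable_generators:
  assumes "countable_dimension scale" "P.subspace W"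
  obtains X where "countable X" "X \<subseteq> W" "W \<subseteq> P.span X"
proof -
  obtain B where B: "span B = UNIV" "countable B" using assms(1) unfolding countable_dimension_def by blast
  interpret vp: vector_space_pair scale scale ..
  have lin: "Vector_Spaces.linear scale scale (\<lambda>x. x)"
    by (simp add: linear_ident)
  obtain g where g: "g ` UNIV \<subseteq> W" "Vector_Spaces.linear scale scale g" "\<forall>x\<in>W. g x = x"
    using vp.linear_exists_left_inverse_on[OF lin P_subspace_imp[OF assms(2)]] by auto
  interpret g: Vector_Spaces.linear scale scale g by (rule g(2))
  have "x \<in> P.span (g ` B)" if "x \<in> W" for x
  proof -
    have "x \<in> g ` span B" using g(3) that B(1) by (metis UNIV_I image_eqI)
    hence "x \<in> span (g ` B)" using g.span_image by blast
    moreover have "span (g ` B) \<subseteq> P.span (g ` B)"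
      by (intro span_minimal P_subspace_imp P.subspace_span) (rule subsetI, rule P.span_base)
    ultimately show ?thesis by blast
  qed
  thus thesis using that[of "g ` B"] B(2) g(1) by blast
qed

section \<open>Primary parts and splitting of kernels\<close>

definition primary :: "'a poly \<Rightarrow> 'v set" where
  "primary f = {x. \<exists>n. act (f ^ n) x = 0}"

lemma act_right_zero: "act f 0 = 0"
  by (rule P.scale_zero_right)

lemma act_multiple_eq_0: "act f x = 0 \<Longrightarrow> f dvd g \<Longrightarrow> act g x = 0"
  by (metis act_mult act_right_zero dvdE mult.commute)

lemma subspace_primary: "P.subspace (primary f)"
proof (rule P.subspaceI)
  show "0 \<in> primary f" unfolding primary_def using act_right_zero by blast
  show "x + y \<in> primary f" if xy: "x \<in> primary f" "y \<in> primary f" for x y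
  proof -
    obtain m n where "act (f ^ m) x = 0" "act (f ^ n) y = 0" using xy unfolding primary_def by blast
    hence "act (f ^ (m + n)) x = 0" "act (f ^ (m + n)) y = 0"
      using act_multiple_eq_0 le_imp_power_dvd by (metis le_add1 le_add2)+
    hence "act (f ^ (m + n)) (x + y) = 0" by (simp add: act_add_right)
    thus ?thesis unfolding primary_def by blast
  qed
  show "act c x \<in> primary f" if x: "x \<in> primary f" for c x
  proof -
    obtain n where n: "act (f ^ n) x = 0" using x unfolding primary_def by blast
    have "act (f ^ n) (act c x) = act c (act (f ^ n) x)" by (simp flip: act_mult add: mult.commute)
    thus ?thesis unfolding primary_def using n act_right_zero by auto
  qed
qed

lemma primary_grading:
  assumes "countable_dimension scale" "p \<in> parity_polys e" "p \<noteq> 0"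
    and irr: "\<And>d. d dvd p \<Longrightarrow> degree d = 0 \<or> p dvd d"
  shows "\<exists>G. P.grading G \<and> P.total G = primary p"
proof -
  interpret Q: graded_primary act parity_polys p e "primary p"
  proof
    fix f
    show "p dvd f \<or> (\<exists>a b. a * f + b * p = 1)"
    proof (cases "p dvd f")
      case False
      have "comaximal f p"
        by (rule comaximal_poly_iff[OF assms(3)]) (use irr False dvd_trans in blast)
      thus ?thesis unfolding comaximal_def by blast
    qed simp
  qed (use assms subspace_primary in \<open>auto simp: primary_def\<close>)
  obtain X where "countable X" "X \<subseteq> primary p" "primary p \<subseteq> P.span X"
    by (rule countable_generators[OF assms(1) subspace_primary])
  thus ?thesis by (rule Q.exists_grading)
qed

lemma comaximal_kernel:
  assumes "comaximal f g" "act (f * g) x = 0"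
  obtains y z where "x = y + z" "act f y = 0" "act g z = 0"
proof -
  obtain a b where ab: "a * f + b * g = 1" using assms(1) unfolding comaximal_def by blast
  have "x = act (b * g) x + act (a * f) x" using act_one ab by (metis act_add_left add.commute)
  moreover have "act f (act (b * g) x) = act b (act (f * g) x)" "act g (act (a * f) x) = act a (act (f * g) x)"
    by (simp_all flip: act_mult add: mult_ac)
  ultimately show thesis using that assms(2) act_right_zero by simp
qed

lemma comaximal_kernel_inter:
  assumes "comaximal f g" "act f x = 0" "act g x = 0" shows "x = 0"
proof -
  obtain a b where ab: "a * f + b * g = 1" using assms(1) unfolding comaximal_def by blast
  have "x = act a (act f x) + act b (act g x)" using act_one ab by (metis act_add_left act_mult)
  thus ?thesis using assms act_right_zero by simp
qed

end

section \<open>The substitution of \<open>-t\<close> for \<open>t\<close> and symmetric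
  polynomials\<close>

definition negate_arg :: "'a::field poly \<Rightarrow> 'a poly" where
  "negate_arg f = f \<circ>\<^sub>p [:0, -1:]"

lemma coeff_negate_arg: "coeff (negate_arg f) i = (-1) ^ i * coeff f i"
  by (simp add: negate_arg_def coeff_pcompose_linear)

lemma negate_arg_mult: "negate_arg (f * g) = negate_arg f * negate_arg g"
  by (simp add: negate_arg_def pcompose_mult)

lemma negate_arg_smult: "negate_arg (smult c f) = smult c (negate_arg f)"
  by (simp add: negate_arg_def pcompose_smult)

lemma negate_arg_power: "negate_arg (f ^ n) = negate_arg f ^ n"
  by (induction n) (simp_all add: negate_arg_mult, simp add: negate_arg_def pcompose_1)

lemma negate_arg_involutive [simp]: "negate_arg (negate_arg f) = f"
  by (rule poly_eqI) (simp add: coeff_negate_arg flip: mult.assoc power_mult_distrib)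

lemma degree_negate_arg [simp]: "degree (negate_arg f) = degree f"
  by (simp add: negate_arg_def degree_pcompose)

lemma negate_arg_eq_0_iff [simp]: "negate_arg f = 0 \<longleftrightarrow> f = 0"
  by (simp add: negate_arg_def pcompose_eq_0_iff)

lemma negate_arg_dvd: "d dvd f \<Longrightarrow> negate_arg d dvd negate_arg f"
  by (auto elim!: dvdE simp: negate_arg_mult)

text \<open>Away from characteristic 2 these are the homogeneous polynomials of the parity grading.
  This form suits divisibility arguments, since \<open>negate_arg\<close> is a ring
  automorphism.\<close>

definition symmetric_poly :: "'a::field poly \<Rightarrow> bool" where
  "symmetric_poly f \<longleftrightarrow> negate_arg f = f \<or> negate_arg f = - f"

lemma symmetric_smult: "symmetric_poly f \<Longrightarrow> symmetric_poly (smult c f)"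
  unfolding symmetric_poly_def by (auto simp: negate_arg_smult)

lemma symmetric_mult_negate_arg: "symmetric_poly (f * negate_arg f)"
  unfolding symmetric_poly_def by (simp add: negate_arg_mult mult.commute)

lemma symmetric_power: "symmetric_poly f \<Longrightarrow> symmetric_poly (f ^ n)"
  unfolding symmetric_poly_def negate_arg_power by (cases "even n") auto

lemma symmetric_cancel:
  assumes "symmetric_poly (f * g)" "symmetric_poly f" "f \<noteq> 0" shows "symmetric_poly g"
proof -
  have "f * negate_arg g = f * g \<or> f * negate_arg g = f * - g"
    using assms(1,2) unfolding symmetric_poly_def negate_arg_mult by (auto simp: minus_equation_iff)
  thus ?thesis using assms(3) unfolding symmetric_poly_def mult_cancel_left by blast
qed

text \<open>Both polynomials have the same degree, so the quotient is constant, and comparing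
  leading coefficients makes it a sign.\<close>

lemma symmetric_if_dvd:
  assumes "d dvd negate_arg d" shows "symmetric_poly d"
proof (cases "d = 0")
  case False
  obtain k where k: "negate_arg d = d * k" using assms by (rule dvdE)
  have "k \<noteq> 0" using k False by auto
  hence "degree d = degree d + degree k" using k False degree_mult_eq degree_negate_arg by metis
  then obtain c where "k = [:c:]" using degree_eq_zeroE by auto
  hence d: "negate_arg d = smult c d" using k by simp
  hence "(-1) ^ degree d * lead_coeff d = c * lead_coeff d"
    using coeff_negate_arg[of d "degree d"] by (metis coeff_smult)
  hence "(-1) ^ degree d = c" using False mult_right_cancel leading_coeff_0_iff by metis
  hence "c = 1 \<or> c = -1" by (cases "even (degree d)") auto
  thus ?thesis using d unfolding symmetric_poly_def by auto
qed (simp add: symmetric_poly_def)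

lemma negate_arg_dvd_symmetric:
  assumes "symmetric_poly f" "d dvd f" shows "negate_arg d dvd f"
  using negate_arg_dvd[OF assms(2)] assms(1) unfolding symmetric_poly_def by auto

text \<open>The substitution permutes the common divisors of \<open>f\<close> and \<open>g\<close>;
  \<open>d\<close> is a combination of \<open>f\<close> and \<open>g\<close>, hence divisible by all
  of them, its own image included.\<close>

lemma symmetric_bezout:
  assumes "symmetric_poly f" "symmetric_poly g"
  shows "\<exists>d a b. d = a * f + b * g \<and> d dvd f \<and> d dvd g \<and> symmetric_poly d"
proof -
  obtain d a b where d: "d = a * f + b * g" "d dvd f" "d dvd g" using poly_bezout by blast
  have "negate_arg d dvd f" "negate_arg d dvd g" using d assms negate_arg_dvd_symmetric by blast+
  hence "negate_arg d dvd d" unfolding d(1) by (intro dvd_add dvd_mult)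
  hence "symmetric_poly d" using negate_arg_dvd symmetric_if_dvd by fastforce
  thus ?thesis using d by blast
qed

lemma symmetric_parity:
  fixes f :: "'a::field poly"
  assumes "symmetric_poly f" "(2::'a) \<noteq> 0" obtains e where "f \<in> parity_polys e"
proof -
  have double: "x = 0" if "- x = x" for x :: 'a
  proof -
    have "2 * x = 0" using that by (metis add.right_inverse mult_2)
    thus ?thesis using assms(2) by simp
  qed
  consider "negate_arg f = f" | "negate_arg f = - f" using assms(1) unfolding symmetric_poly_def by blast
  thus thesis
  proof cases
    case 1
    hence "(-1) ^ i * coeff f i = coeff f i" for i using coeff_negate_arg by metis
    hence "odd i \<Longrightarrow> coeff f i = 0" for i using double by (metis mult_minus1 neg_one_odd_power)
    thus thesis using that[of False] unfolding parity_polys_def by auto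
  next
    case 2
    hence "(-1) ^ i * coeff f i = - coeff f i" for i using coeff_negate_arg coeff_minus by metis
    hence "even i \<Longrightarrow> coeff f i = 0" for i using double by (metis mult_1 neg_one_even_power)
    thus thesis using that[of True] unfolding parity_polys_def by auto
  qed
qed

text \<open>Such a \<open>p\<close> is irreducible, or else an associate of \<open>r * negate_arg r\<close> for an irreducible \<open>r\<close>.\<close>

definition symmetric_primes :: "'a::field poly set" where
  "symmetric_primes = {p. lead_coeff p = 1 \<and> symmetric_poly p \<and> degree p > 0 \<and>
     (\<forall>d. symmetric_poly d \<longrightarrow> d dvd p \<longrightarrow> degree d = 0 \<or> p dvd d)}"

lemma symmetric_primesD:
  assumes "p \<in> symmetric_primes"
  shows "lead_coeff p = 1" "symmetric_poly p" "degree p > 0" "p \<noteq> 0"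
    "symmetric_poly d \<Longrightarrow> d dvd p \<Longrightarrow> degree d = 0 \<or> p dvd d"
  using assms unfolding symmetric_primes_def by auto

lemma symmetric_prime_divisor:
  fixes f :: "'a::field poly"
  assumes f: "symmetric_poly f" "degree f > 0"
  obtains p where "p \<in> symmetric_primes" "p dvd f"
proof -
  let ?P = "\<lambda>d. symmetric_poly d \<and> d dvd f \<and> degree d > 0"
  have "?P f" using f by simp
  from ex_has_least_nat[of ?P f degree, OF this] obtain p where p: "?P p"
    and min: "\<And>d. ?P d \<Longrightarrow> degree p \<le> degree d" by blast
  define c where "c = inverse (lead_coeff p)"
  have p0: "p \<noteq> 0" using p by auto
  hence c: "c \<noteq> 0" by (simp add: c_def)
  have "smult c p \<in> symmetric_primes" unfolding symmetric_primes_def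
  proof (intro CollectI conjI allI impI)
    show "lead_coeff (smult c p) = 1" using p0 by (simp add: c_def)
    show "symmetric_poly (smult c p)" using p symmetric_smult by blast
    show "degree (smult c p) > 0" using c p by simp
    fix d assume d: "symmetric_poly d" "d dvd smult c p"
    have dp: "d dvd p" using d(2) c by (simp add: dvd_smult_iff)
    show "degree d = 0 \<or> smult c p dvd d"
    proof (cases "degree d = 0")
      case False
      hence "degree p \<le> degree d" using min d(1) dp p dvd_trans by blast
      hence "p dvd d" using dvd_degree_eq_imp_dvd dp p0 by blast
      thus ?thesis using c by (simp add: smult_dvd_iff)
    qed simp
  qed
  moreover have "smult c p dvd f" using p c by (simp add: smult_dvd_iff)
  ultimately show thesis using that by blast
qed

lemma symmetric_prime_comaximal:
  assumes p: "p \<in> symmetric_primes" and "symmetric_poly g" "\<not> p dvd g"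
  shows "comaximal p g"
proof -
  obtain d a b where d: "d = a * p + b * g" "d dvd p" "d dvd g" "symmetric_poly d"
    using symmetric_bezout[OF symmetric_primesD(2)[OF p] assms(2)] by blast
  have "degree d = 0" using symmetric_primesD(5)[OF p d(4,2)] d(3) assms(3) dvd_trans by blast
  then obtain c where c: "d = [:c:]" using degree_eq_zeroE by blast
  have "c \<noteq> 0" using c d(2) symmetric_primesD(4)[OF p] by auto
  hence "[:1 / c:] * d = 1" using c by (simp add: one_pCons)
  hence "([:1 / c:] * a) * p + ([:1 / c:] * b) * g = 1" unfolding d(1) by (simp only: algebra_simps)
  thus ?thesis unfolding comaximal_def by blast
qed

text \<open>Monic normalization leaves one representative of each associate class, so that these
  polynomials can index independent primary parts.\<close>

lemma symmetric_primes_comaximal: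
  assumes p: "p \<in> symmetric_primes" and q: "q \<in> symmetric_primes" and "p \<noteq> q"
  shows "comaximal p q"
proof (rule symmetric_prime_comaximal[OF p symmetric_primesD(2)[OF q]])
  show "\<not> p dvd q"
  proof
    assume pq: "p dvd q"
    hence "q dvd p" using symmetric_primesD(5)[OF q symmetric_primesD(2)[OF p]] symmetric_primesD(3)[OF p] by simp
    obtain k where k: "q = p * k" using pq by (rule dvdE)
    have "degree q \<le> degree p" using \<open>q dvd p\<close> symmetric_primesD(4)[OF p] by (rule dvd_imp_degree_le)
    moreover have "p \<noteq> 0" "k \<noteq> 0" using k symmetric_primesD(4)[OF q] by auto
    ultimately have "degree k = 0" using k degree_mult_eq by fastforce
    then obtain c where "k = [:c:]" using degree_eq_zeroE by blast
    hence "q = smult c p" using k by simp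
    moreover from this have "c = 1"
      using symmetric_primesD(1)[OF p] symmetric_primesD(1)[OF q] by (simp split: if_splits)
    ultimately have "p = q" by simp
    thus False using \<open>p \<noteq> q\<close> by blast
  qed
qed

lemma X_power_decomposition:
  fixes f :: "'a::field poly"
  shows "f \<noteq> 0 \<Longrightarrow> \<exists>n g. f = [:0, 1:] ^ n * g \<and> coeff g 0 \<noteq> 0"
proof (induction f)
  case (pCons a f)
  show ?case
  proof (cases "a = 0")
    case True
    then obtain n g where "f = [:0, 1:] ^ n * g" "coeff g 0 \<noteq> 0" using pCons by auto
    hence "pCons a f = [:0, 1:] ^ Suc n * g" using True by simp
    thus ?thesis using \<open>coeff g 0 \<noteq> 0\<close> by blast
  next
    case False
    thus ?thesis by (intro exI[of _ 0] exI[of _ "pCons a f"]) simp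
  qed
qed simp

lemma X_comaximal:
  fixes f :: "'a::field poly"
  assumes "coeff f 0 \<noteq> 0" shows "comaximal [:0, 1:] f"
proof -
  obtain c g where f: "f = pCons c g" by (rule pCons_cases)
  \<comment> \<open>This is \<open>f = c + t g\<close> divided by \<open>c\<close>.\<close>
  have "(- smult (1 / c) g) * [:0, 1:] + [:1 / c:] * f = 1"
    using assms f by (simp add: one_pCons)
  thus ?thesis unfolding comaximal_def by blast
qed

section \<open>Sums of two square-zero endomorphisms\<close>

context poly_module
begin

text \<open>Meant for the square-zero summands of \<open>u\<close>, which commute with
  \<open>u\<^sup>2\<close> but need not commute with \<open>u\<close>.\<close>

lemma even_commute:
  assumes add: "\<And>x y. a (x + y) = a x + a y" and sc: "\<And>c x. a (scale c x) = scale c (a x)"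
    and comm: "\<And>x. a (u (u x)) = u (u (a x))" and f: "f \<in> parity_polys False"
  shows "a (act f x) = act f (a x)"
proof -
  have zero: "a 0 = 0" using sc[of 0 0] by simp
  \<comment> \<open>The odd case carries an extra \<open>u\<close>, so that only powers of
    \<open>u\<^sup>2\<close> occur and the induction can alternate between the parities.\<close>
  have "(f \<in> parity_polys False \<longrightarrow> a (act f x) = act f (a x)) \<and>
        (f \<in> parity_polys True \<longrightarrow> a (u (act f x)) = u (act f (a x)))"
  proof (induction f)
    case (pCons c f)
    show ?case
    proof (intro conjI impI)
      assume "pCons c f \<in> parity_polys False"
      hence "f \<in> parity_polys True" by (simp add: parity_pCons)
      thus "a (act (pCons c f) x) = act (pCons c f) (a x)" using pCons by (simp add: add sc)
    next
      assume "pCons c f \<in> parity_polys True"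
      hence "f \<in> parity_polys False" "c = 0" by (auto simp: parity_pCons)
      thus "a (u (act (pCons c f) x)) = u (act (pCons c f) (a x))" using pCons comm by simp
    qed
  qed (simp add: zero u_zero)
  thus ?thesis using f by blast
qed

text \<open>The sum of the primary parts for all irreducible polynomials not associated to
  \<open>t\<close>, described without decomposing it further.\<close>

definition coprime_to_X :: "'v set" where
  "coprime_to_X = {x. \<exists>f. coeff f 0 \<noteq> 0 \<and> act f x = 0}"

lemma subspace_coprime_to_X: "P.subspace coprime_to_X"
proof (rule P.subspaceI)
  show "0 \<in> coprime_to_X"
    unfolding coprime_to_X_def by (auto intro!: exI[of _ 1] simp: act_right_zero)
  show "x + y \<in> coprime_to_X" if xy: "x \<in> coprime_to_X" "y \<in> coprime_to_X" for x y
  proof -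
    obtain f where f: "coeff f 0 \<noteq> 0" "act f x = 0" using xy(1) unfolding coprime_to_X_def by blast
    obtain g where g: "coeff g 0 \<noteq> 0" "act g y = 0" using xy(2) unfolding coprime_to_X_def by blast
    have "act (f * g) (x + y) = 0"
      using act_multiple_eq_0[OF f(2), of "f * g"] act_multiple_eq_0[OF g(2), of "f * g"]
      by (simp add: act_add_right)
    moreover have "coeff (f * g) 0 \<noteq> 0" using f g by (simp add: coeff_mult_0)
    ultimately show ?thesis unfolding coprime_to_X_def by blast
  qed
  show "act c x \<in> coprime_to_X" if x: "x \<in> coprime_to_X" for c x
  proof -
    obtain f where f: "coeff f 0 \<noteq> 0" "act f x = 0" using x unfolding coprime_to_X_def by blast
    have "act f (act c x) = act c (act f x)" by (simp flip: act_mult add: mult.commute)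
    hence "act f (act c x) = 0" using f act_right_zero by simp
    thus ?thesis unfolding coprime_to_X_def using f by blast
  qed
qed

text \<open>Even annihilators carry over to \<open>a x\<close> and \<open>b x\<close> for the
  square-zero summands \<open>a\<close>, \<open>b\<close> of \<open>u\<close>. If \<open>g\<close>
  and \<open>h\<close> are the even and odd part of an annihilator, \<open>(g - h) (g + h)\<close>
  is even, and its constant term is the square of the old one.\<close>

lemma coprime_to_X_even:
  assumes "x \<in> coprime_to_X"
  obtains f where "f \<in> parity_polys False" "coeff f 0 \<noteq> 0" "act f x = 0"
proof -
  obtain f where f: "coeff f 0 \<noteq> 0" "act f x = 0" using assms unfolding coprime_to_X_def by blast
  obtain g h where gh: "g \<in> parity_polys False" "h \<in> parity_polys True" "f = g + h"
    using parity_decomp by blast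
  have h0: "coeff h 0 = 0" using gh(2) unfolding parity_polys_def by auto
  let ?k = "g * g - h * h"
  have "g * g \<in> parity_polys False" "h * h \<in> parity_polys False"
    using parity_mult[OF gh(1) gh(1)] parity_mult[OF gh(2) gh(2)] by simp_all
  hence "?k \<in> parity_polys False" by (rule P.H_diff)
  moreover have "coeff ?k 0 \<noteq> 0" using f(1) h0 gh(3) by (simp add: coeff_mult_0)
  moreover have "?k = (g - h) * f" unfolding gh(3) by (simp add: algebra_simps)
  hence "act ?k x = 0" using f(2) act_multiple_eq_0 by (metis dvd_triv_right)
  ultimately show thesis by (rule that)
qed

text \<open>With \<open>f = c + t g\<close> and \<open>c\<close> nonzero, the equation
  \<open>f(u) x = 0\<close> can be solved for \<open>x\<close> as a value of
  \<open>u\<close>.\<close>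

lemma coprime_to_X_preimage:
  assumes "x \<in> coprime_to_X" obtains y where "y \<in> coprime_to_X" "x = u y"
proof -
  obtain f where f: "coeff f 0 \<noteq> 0" "act f x = 0" using assms unfolding coprime_to_X_def by blast
  obtain c g where cg: "f = pCons c g" by (rule pCons_cases)
  have c: "c \<noteq> 0" using f cg by simp
  have "scale c x = - u (act g x)" using f(2) cg by (simp add: eq_neg_iff_add_eq_0)
  also have "\<dots> = u (- act g x)" by (simp add: u_minus)
  finally have "u (scale (1 / c) (- act g x)) = scale (1 / c) (scale c x)" by (simp only: u_scale)
  hence "x = u (scale (1 / c) (- act g x))" using c by simp
  moreover have "scale (1 / c) (- act g x) \<in> coprime_to_X"
    using subspace_scale subspace_neg P_subspace_imp[OF subspace_coprime_to_X]
      P.subspace_scale[OF subspace_coprime_to_X assms] by blast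
  ultimately show thesis using that by blast
qed

lemma u_coprime_to_X: "x \<in> coprime_to_X \<Longrightarrow> u x \<in> coprime_to_X"
  using P.subspace_scale[OF subspace_coprime_to_X, of x "[:0, 1:]"] by (simp add: u_zero)

lemma u_inj_coprime_to_X:
  assumes "x \<in> coprime_to_X" "u x = 0" shows "x = 0"
proof -
  obtain f where f: "coeff f 0 \<noteq> 0" "act f x = 0" using assms unfolding coprime_to_X_def by blast
  thus ?thesis using comaximal_kernel_inter[OF X_comaximal[OF f(1)], of x] assms(2) by (simp add: u_zero)
qed

text \<open>
  With \<open>a\<^sup>2 = b\<^sup>2 = 0\<close> one has \<open>u\<^sup>2 = ab + ba\<close>, which commutes with \<open>a\<close> and \<open>b\<close>; where \<open>u\<close> is
  bijective this makes the kernels of \<open>a\<close> and \<open>b\<close> complementary, and \<open>u\<close> exchanges them.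
\<close>

lemma coprime_to_X_grading:
  assumes a: "square_zero scale a" and b: "square_zero scale b" and u: "u = (\<lambda>x. a x + b x)"
  shows "\<exists>G. P.grading G \<and> P.total G = coprime_to_X"
proof -
  interpret a: Vector_Spaces.linear scale scale a using a unfolding square_zero_def by blast
  interpret b: Vector_Spaces.linear scale scale b using b unfolding square_zero_def by blast
  have aa: "a (a x) = 0" and bb: "b (b x) = 0" for x
    using a b unfolding square_zero_def comp_def by metis+
  have ux: "u x = a x + b x" for x by (simp add: u)
  have uu: "u (u x) = a (b x) + b (a x)" for x
    by (simp add: ux a.add b.add aa bb)
  have stable: "c x \<in> coprime_to_X" if c: "c = a \<or> c = b" and x: "x \<in> coprime_to_X" for c x
  proof -
    have lin: "c (x + y) = c x + c y" "c (scale k x) = scale k (c x)" for x y k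
      using c a.add b.add a.scale b.scale by auto
    have comm: "c (u (u x)) = u (u (c x))" for x
      using c by (auto simp: uu a.add b.add aa bb)
    have c0: "c 0 = 0" using lin(2)[of 0 0] by simp
    obtain f where f: "f \<in> parity_polys False" "coeff f 0 \<noteq> 0" "act f x = 0"
      using x by (rule coprime_to_X_even)
    have "act f (c x) = 0" using even_commute[OF lin comm f(1), of x] f(3) c0 by simp
    thus ?thesis unfolding coprime_to_X_def using f(2) by blast
  qed
  note sub = P_subspace_imp[OF subspace_coprime_to_X]
  define G where "G d = {x \<in> coprime_to_X. (if d then a x else b x) = 0}" for d
  have "P.grading G"
  proof (rule gradingI)
    show "0 \<in> G d" for d unfolding G_def using subspace_0[OF sub] by simp
    show "x + y \<in> G d" if "x \<in> G d" "y \<in> G d" for d x y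
      using that subspace_add[OF sub] unfolding G_def by (auto simp: a.add b.add split: if_splits)
    show "scale c x \<in> G d" if "x \<in> G d" for d c x
      using that subspace_scale[OF sub] unfolding G_def by (auto simp: a.scale b.scale split: if_splits)
    show "u x \<in> G (\<not> d)" if "x \<in> G d" for d x
      using that u_coprime_to_X unfolding G_def by (auto simp: ux a.add b.add aa bb split: if_splits)
    show "x = 0" if "x \<in> G True" "x \<in> G False" for x
      using that u_inj_coprime_to_X unfolding G_def by (auto simp: ux)
  qed
  moreover have "P.total G = coprime_to_X"
  proof (intro equalityI subsetI)
    fix x assume "x \<in> P.total G"
    thus "x \<in> coprime_to_X" unfolding P.total_def G_def using subspace_add[OF sub] by auto
  next
    fix x assume "x \<in> coprime_to_X"
    \<comment> \<open>Surjectivity of \<open>u\<close> is used twice, because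
      \<open>u\<^sup>2 = ab + ba\<close> displays the components: \<open>a (b z)\<close> is killed
      by \<open>a\<close>, and \<open>b (a z)\<close> by \<open>b\<close>.\<close>
    then obtain y where "y \<in> coprime_to_X" "x = u y" by (rule coprime_to_X_preimage)
    moreover from this(1) obtain z where "z \<in> coprime_to_X" "y = u z" by (rule coprime_to_X_preimage)
    ultimately have z: "z \<in> coprime_to_X" "x = a (b z) + b (a z)" by (auto simp: uu)
    have "a (b z) \<in> G True" "b (a z) \<in> G (\<not> True)"
      using stable z(1) aa bb unfolding G_def by auto
    thus "x \<in> P.total G" unfolding z(2) by (rule P.totalI)
  qed
  ultimately show ?thesis by blast
qed

theorem exchange_of_square_zero_sum:
  assumes cd: "countable_dimension scale" and tors: "\<And>x. \<exists>f. f \<noteq> 0 \<and> act f x = 0"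
    and ab: "square_zero scale a" "square_zero scale b" "u = (\<lambda>x. a x + b x)"
  shows "exchange_property scale u"
proof -
  let ?X = "[:0, 1:] :: 'a poly"
  have irr: "degree d = 0 \<or> ?X dvd d" if "d dvd ?X" for d
  proof -
    have "degree d = 0 \<or> degree ?X \<le> degree d" by auto
    thus ?thesis using dvd_degree_eq_imp_dvd[OF that] by auto
  qed
  have "?X \<noteq> 0" by simp
  from primary_grading[OF cd parity_X this irr]
  obtain G1 where G1: "P.grading G1" "P.total G1 = primary ?X" by blast
  obtain G0 where G0: "P.grading G0" "P.total G0 = coprime_to_X"
    using coprime_to_X_grading[OF ab] by blast
  have disj: "x = 0" if x: "x \<in> primary ?X" "x \<in> coprime_to_X" for x
  proof -
    obtain n where n: "act (?X ^ n) x = 0" using x(1) unfolding primary_def by blast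
    obtain f where f: "coeff f 0 \<noteq> 0" "act f x = 0" using x(2) unfolding coprime_to_X_def by blast
    have "comaximal (?X ^ n) f" using comaximal_powers[OF X_comaximal[OF f(1)], of n 1] by simp
    thus ?thesis using comaximal_kernel_inter n f(2) by blast
  qed
  define G where "G i = (if i then G1 else G0)" for i
  have G: "P.grading (G i)" for i unfolding G_def using G1 G0 by simp
  have "x i = 0" if J: "\<And>i. i \<in> J \<Longrightarrow> x i \<in> P.total (G i)" "sum x J = 0" "i \<in> J" for J x i
  proof -
    \<comment> \<open>Padding with \<open>0\<close> turns a sum over an arbitrary \<open>J\<close>
      into \<open>y True + y False\<close>.\<close>
    define y where "y j = (if j \<in> J then x j else 0)" for j
    have "sum x J = sum y UNIV" unfolding y_def by (rule sum.mono_neutral_cong_left) auto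
    hence "y True + y False = 0" using J(2) by (simp add: UNIV_bool add.commute)
    hence eq: "y True = - y False" by (simp add: eq_neg_iff_add_eq_0)
    have "y j \<in> P.total (G j)" for j
      unfolding y_def using J(1) P.subspace_0[OF P.subspace_total[OF G]] by simp
    from this[of True] this[of False] have y: "y True \<in> primary ?X" "y False \<in> coprime_to_X"
      unfolding G_def using G1 G0 by simp_all
    have "y True \<in> coprime_to_X" unfolding eq using y(2) P.subspace_neg[OF subspace_coprime_to_X] by blast
    hence "y True = 0" using disj y(1) by blast
    hence "y j = 0" for j using eq by (cases j) auto
    thus ?thesis using J(3) unfolding y_def by metis
  qed
  then obtain K where K: "P.grading K" "\<And>i. P.total (G i) \<subseteq> P.total K"
    using P.combine_gradings[of UNIV G, OF G] by blast
  have "x \<in> P.total K" for x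
  proof -
    obtain f where "f \<noteq> 0" "act f x = 0" using tors by blast
    moreover from X_power_decomposition[OF this(1)]
    obtain n g where "f = ?X ^ n * g" and g: "coeff g 0 \<noteq> 0" by blast
    ultimately have "act (?X ^ n * g) x = 0" by simp
    moreover have "comaximal (?X ^ n) g" using comaximal_powers[OF X_comaximal[OF g], of n 1] by simp
    ultimately obtain y z where yz: "x = y + z" "act (?X ^ n) y = 0" "act g z = 0"
      by (metis comaximal_kernel)
    have "y \<in> primary ?X" using yz(2) unfolding primary_def by blast
    hence "y \<in> P.total K" using K(2)[of True] G1 unfolding G_def by auto
    moreover have "z \<in> coprime_to_X" using yz(3) g unfolding coprime_to_X_def by blast
    hence "z \<in> P.total K" using K(2)[of False] G0 unfolding G_def by auto
    ultimately show ?thesis using yz(1) P.subspace_add[OF P.subspace_total[OF K(1)]] by blast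
  qed
  hence "P.total K = UNIV" by blast
  thus ?thesis using exchange_of_grading K(1) by blast
qed


section \<open>Decomposition into symmetric primary parts\<close>

text \<open>Splitting off the full power of one symmetric prime leaves a symmetric cofactor of
  smaller degree that is coprime to it, and the vector splits accordingly.\<close>

lemma mem_if_killed_by_symmetric:
  assumes U: "P.subspace U" "\<And>p. p \<in> symmetric_primes \<Longrightarrow> primary p \<subseteq> U"
    and f: "symmetric_poly f" "f \<noteq> 0" "act f x = 0"
  shows "x \<in> U"
  using f
proof (induction "degree f" arbitrary: f x rule: less_induct)
  case less
  show ?case
  proof (cases "degree f = 0")
    case True
    then obtain c where c: "f = [:c:]" using degree_eq_zeroE by blast
    hence "scale c x = 0" "c \<noteq> 0" using less.prems by (auto simp: u_zero)
    hence "x = 0" by simp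
    thus ?thesis using P.subspace_0[OF U(1)] by simp
  next
    case False
    then obtain p where p: "p \<in> symmetric_primes" "p dvd f"
      using symmetric_prime_divisor[OF less.prems(1)] by blast
    note D = symmetric_primesD[OF p(1)]
    have bound: "k \<le> degree f" if "p ^ k dvd f" for k
    proof -
      have "k * degree p \<le> degree f"
        using dvd_imp_degree_le[OF that less.prems(2)] degree_power_eq[OF D(4)] by simp
      moreover have "k \<le> k * degree p" using D(3) by simp
      ultimately show ?thesis by linarith
    qed
    have "p ^ 1 dvd f" using p(2) by simp
    from Nat.ex_has_greatest_nat[of "\<lambda>k. p ^ k dvd f", OF this] bound
    obtain k where k: "p ^ k dvd f" "\<And>m. p ^ m dvd f \<Longrightarrow> m \<le> k" by blast
    have "k \<ge> 1" using k(2)[of 1] p(2) by simp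
    obtain g where g: "f = p ^ k * g" using k(1) by (rule dvdE)
    have "\<not> p dvd g"
    proof
      assume "p dvd g"
      then obtain h where "g = p * h" by (rule dvdE)
      hence "p ^ Suc k dvd f" using g by simp
      thus False using k(2)[of "Suc k"] by simp
    qed
    have pk: "p ^ k \<noteq> 0" using D(4) by simp
    have symg: "symmetric_poly g"
      using symmetric_cancel[OF _ symmetric_power[OF D(2)] pk] less.prems(1) g by blast
    have "comaximal p g" using symmetric_prime_comaximal[OF p(1) symg \<open>\<not> p dvd g\<close>] .
    hence "comaximal (p ^ k) g" using comaximal_powers[of p g k 1] by simp
    then obtain y z where yz: "x = y + z" "act (p ^ k) y = 0" "act g z = 0"
      using comaximal_kernel less.prems(3) g by metis
    have "g \<noteq> 0" using g less.prems(2) by auto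
    moreover have "degree g < degree f"
    proof -
      have "degree f = k * degree p + degree g"
        unfolding g degree_mult_eq[OF pk \<open>g \<noteq> 0\<close>] degree_power_eq[OF D(4)] ..
      moreover have "k * degree p > 0" using D(3) \<open>k \<ge> 1\<close> by simp
      ultimately show ?thesis by linarith
    qed
    ultimately have "z \<in> U" using less.hyps symg yz(3) by blast
    moreover have "y \<in> U" using U(2)[OF p(1)] yz(2) unfolding primary_def by blast
    ultimately show ?thesis using yz(1) P.subspace_add[OF U(1)] by blast
  qed
qed

text \<open>The product \<open>Q\<close> of the annihilating powers for the other indices kills all
  other terms, hence \<open>x p\<close> as well, which is also killed by a power of \<open>p\<close>
  coprime to \<open>Q\<close>.\<close>

lemma primary_independent:
  assumes J: "finite J" "\<And>p q. p \<in> J \<Longrightarrow> q \<in> J \<Longrightarrow> p \<noteq> q \<Longrightarrow> comaximal p q"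
    and x: "\<And>p. p \<in> J \<Longrightarrow> x p \<in> primary p" "sum x J = 0" and p: "p \<in> J"
  shows "x p = 0"
proof -
  have "\<forall>p\<in>J. \<exists>n. act (p ^ n) (x p) = 0" using x(1) unfolding primary_def by blast
  then obtain k where k: "\<And>p. p \<in> J \<Longrightarrow> act (p ^ k p) (x p) = 0" by metis
  define Q where "Q = (\<Prod>q\<in>J - {p}. q ^ k q)"
  have com: "comaximal (p ^ k p) Q" unfolding Q_def
    by (intro comaximal_prod comaximal_powers) (use J(2) p in blast)
  have Q0: "act Q (x q) = 0" if "q \<in> J - {p}" for q
  proof -
    have "q ^ k q dvd Q" unfolding Q_def using J(1) that by (intro dvd_prodI) auto
    thus ?thesis using act_multiple_eq_0 k that by blast
  qed
  have "sum x J = x p + sum x (J - {p})" using J(1) p by (simp add: sum.remove)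
  hence "x p = - sum x (J - {p})" using x(2) by (simp add: eq_neg_iff_add_eq_0)
  hence "act Q (x p) = - (\<Sum>q\<in>J - {p}. act Q (x q))"
    by (simp add: P.scale_sum_right)
  also have "\<dots> = 0" using Q0 by simp
  finally show ?thesis using comaximal_kernel_inter[OF com] k p by blast
qed

section \<open>Endomorphisms similar to their negative\<close>

context
  fixes \<phi> :: "'v \<Rightarrow> 'v"
  assumes linear_phi: "Vector_Spaces.linear scale scale \<phi>" and bij_phi: "bij \<phi>"
    and phi_u: "\<phi> (u x) = - u (\<phi> x)"
begin

lemma phi_add: "\<phi> (x + y) = \<phi> x + \<phi> y"
  and phi_scale: "\<phi> (scale c x) = scale c (\<phi> x)"
  and phi_zero: "\<phi> 0 = 0"
proof -
  interpret phi: Vector_Spaces.linear scale scale \<phi> by (rule linear_phi)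
  show "\<phi> (x + y) = \<phi> x + \<phi> y" "\<phi> (scale c x) = scale c (\<phi> x)" "\<phi> 0 = 0"
    by (simp_all add: phi.add phi.scale)
qed

lemma phi_act: "\<phi> (act f x) = act (negate_arg f) (\<phi> x)"
proof (induction f)
  case 0
  have "negate_arg 0 = (0::'a poly)" by simp
  thus ?case by (simp add: phi_zero del: negate_arg_eq_0_iff)
next
  case (pCons a f)
  have "negate_arg (pCons a f) = [:a:] + pCons 0 (- negate_arg f)"
    by (simp add: negate_arg_def pcompose_pCons)
  hence "act (negate_arg (pCons a f)) (\<phi> x) = scale a (\<phi> x) + u (act (- negate_arg f) (\<phi> x))"
    by (simp add: act_add_left u_zero)
  also have "act (- negate_arg f) (\<phi> x) = - act (negate_arg f) (\<phi> x)" by simp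
  finally show ?case using pCons.IH by (simp add: phi_add phi_scale phi_u u_minus)
qed

lemma phi_primary_iff: "\<phi> x \<in> primary (negate_arg f) \<longleftrightarrow> x \<in> primary f"
proof -
  have "act (negate_arg f ^ n) (\<phi> x) = 0 \<longleftrightarrow> act (f ^ n) x = 0" for n
    using phi_act[of "f ^ n" x] phi_zero bij_phi
    by (metis bij_pointE negate_arg_power)
  thus ?thesis unfolding primary_def by blast
qed

lemma symmetric_primary_grading:
  assumes cd: "countable_dimension scale" and two: "(2::'a) \<noteq> 0" and p: "p \<in> symmetric_primes"
  shows "\<exists>G. P.grading G \<and> P.total G = primary p"
proof (cases "\<forall>d. d dvd p \<longrightarrow> degree d = 0 \<or> p dvd d")
  case True
  obtain e where "p \<in> parity_polys e" using symmetric_parity[OF symmetric_primesD(2)[OF p] two] by blast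
  thus ?thesis using primary_grading[OF cd _ symmetric_primesD(4)[OF p]] True by blast
next
  case False
  note D = symmetric_primesD[OF p]
  let ?P = "\<lambda>d. d dvd p \<and> degree d > 0"
  obtain d where d: "d dvd p" "degree d \<noteq> 0" "\<not> p dvd d" using False by blast
  hence "?P d" by simp
  from ex_has_least_nat[of ?P d degree, OF this] obtain r where r: "r dvd p" "degree r > 0"
    and min: "\<And>d. d dvd p \<Longrightarrow> degree d > 0 \<Longrightarrow> degree r \<le> degree d" by blast
  let ?s = "negate_arg r"
  have r0: "r \<noteq> 0" using r by auto
  \<comment> \<open>A symmetric \<open>r\<close> would be divisible by \<open>p\<close>; by
    minimality every nonconstant divisor of \<open>p\<close> would then have full degree, against
    the case assumption.\<close>
  have "\<not> symmetric_poly r"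
  proof
    assume "symmetric_poly r"
    hence "p dvd r" using D(5) r by fastforce
    hence "degree p \<le> degree d"
      using min[OF d(1)] d(2) dvd_imp_degree_le r0 by fastforce
    thus False using dvd_degree_eq_imp_dvd[OF d(1) D(4)] d(3) by blast
  qed
  have com: "comaximal r ?s"
  proof (rule comaximal_poly_iff)
    fix c assume c: "c dvd r" "c dvd ?s"
    show "degree c = 0"
    proof (rule ccontr)
      assume "degree c \<noteq> 0"
      hence "degree r \<le> degree c" using min c(1) r(1) dvd_trans by blast
      hence "r dvd c" using dvd_degree_eq_imp_dvd c(1) r0 by blast
      hence "symmetric_poly r" using c(2) dvd_trans symmetric_if_dvd by blast
      thus False using \<open>\<not> symmetric_poly r\<close> by blast
    qed
  qed (use r0 in simp)
  have "?s dvd p" using negate_arg_dvd_symmetric[OF D(2) r(1)] .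
  have "degree (r * ?s) \<noteq> 0" using degree_mult_eq[OF r0, of ?s] r0 r(2) by simp
  hence pdvd: "p dvd r * ?s"
    using D(5)[OF symmetric_mult_negate_arg comaximal_mult_dvd[OF com r(1) \<open>?s dvd p\<close>]] by simp
  have sub: "primary r \<subseteq> primary p" "primary ?s \<subseteq> primary p"
    unfolding primary_def using act_multiple_eq_0 dvd_power_same r(1) \<open>?s dvd p\<close> by blast+
  have inter: "x = 0" if x: "x \<in> primary r" "x \<in> primary ?s" for x
  proof -
    obtain m n where "act (r ^ m) x = 0" "act (?s ^ n) x = 0" using x unfolding primary_def by blast
    thus ?thesis using comaximal_kernel_inter comaximal_powers[OF com] by blast
  qed
  note subr = P_subspace_imp[OF subspace_primary[of r]]
  note subs = P_subspace_imp[OF subspace_primary[of ?s]]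
  \<comment> \<open>\<open>u\<close> sends \<open>x + \<phi> x\<close> to
    \<open>u x - \<phi> (u x)\<close>: the sign in \<open>\<phi> u = - u \<phi>\<close> becomes the
    change of degree.\<close>
  define \<sigma> where "\<sigma> b x = (if b then \<phi> x else - \<phi> x)" for b x
  have sigma_add: "\<sigma> b (x + y) = \<sigma> b x + \<sigma> b y" for b x y
    unfolding \<sigma>_def by (simp add: phi_add)
  have sigma_scale: "\<sigma> b (scale c x) = scale c (\<sigma> b x)" for b c x
    unfolding \<sigma>_def by (simp add: phi_scale)
  have sigma_u: "u (\<sigma> b x) = \<sigma> (\<not> b) (u x)" for b x
    unfolding \<sigma>_def by (simp add: phi_u u_minus)
  define G where "G b = (\<lambda>x. x + \<sigma> b x) ` primary r" for b
  have GI: "x + \<sigma> b x \<in> G b" if "x \<in> primary r" for x b unfolding G_def using that by blast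
  have GE: "\<exists>x\<in>primary r. y = x + \<sigma> b x" if "y \<in> G b" for y b using that unfolding G_def by blast
  have G: "P.grading G"
  proof (rule gradingI)
    show "0 \<in> G b" for b using GI[OF subspace_0[OF subr], of b] by (simp add: \<sigma>_def phi_zero split: if_splits)
    show "y + z \<in> G b" if yz: "y \<in> G b" "z \<in> G b" for b y z
    proof -
      obtain x where x: "x \<in> primary r" "y = x + \<sigma> b x" using GE yz(1) by blast
      obtain w where w: "w \<in> primary r" "z = w + \<sigma> b w" using GE yz(2) by blast
      have "y + z = (x + w) + \<sigma> b (x + w)" using x w by (simp add: sigma_add algebra_simps)
      thus ?thesis using GI subspace_add[OF subr x(1) w(1)] by simp
    qed
    show "scale c y \<in> G b" if y: "y \<in> G b" for b c y
    proof -
      obtain x where x: "x \<in> primary r" "y = x + \<sigma> b x" using GE y by blast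
      have "scale c y = scale c x + \<sigma> b (scale c x)" using x by (simp add: sigma_scale scale_right_distrib)
      thus ?thesis using GI subspace_scale[OF subr x(1)] by simp
    qed
    show "u y \<in> G (\<not> b)" if y: "y \<in> G b" for b y
    proof -
      obtain x where x: "x \<in> primary r" "y = x + \<sigma> b x" using GE y by blast
      have "u y = u x + \<sigma> (\<not> b) (u x)" using x by (simp add: u_add sigma_u)
      moreover have "u x \<in> primary r"
        using P.subspace_scale[OF subspace_primary x(1), of "[:0, 1:]"] by (simp add: u_zero)
      ultimately show ?thesis using GI by simp
    qed
    show "y = 0" if y: "y \<in> G True" "y \<in> G False" for y
    proof -
      obtain x where x: "x \<in> primary r" "y = x + \<phi> x" using GE[OF y(1)] unfolding \<sigma>_def by auto
      obtain w where w: "w \<in> primary r" "y = w - \<phi> w" using GE[OF y(2)] unfolding \<sigma>_def by auto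
      \<comment> \<open>The left side lies in the \<open>r\<close>-primary part and the right side
        in the complementary one, so both vanish.\<close>
      have eq: "x - w = - \<phi> (x + w)" using x(2) w(2) by (simp add: phi_add algebra_simps)
      have "x - w \<in> primary r" using subspace_diff[OF subr x(1) w(1)] .
      moreover have "x - w \<in> primary ?s" unfolding eq
        using phi_primary_iff subspace_add[OF subr x(1) w(1)] subspace_neg[OF subs] by blast
      ultimately have "x = w" using inter by fastforce
      hence "\<phi> (x + x) = \<phi> 0" using eq phi_zero by simp
      hence "x + x = 0" using bij_phi by (metis bij_pointE)
      hence "scale 2 x = 0" using scale_left_distrib[of 1 1 x] by simp
      hence "x = 0" using two by simp
      thus ?thesis using x(2) phi_zero by simp
    qed
  qed
  moreover have "P.total G = primary p"
  proof (intro equalityI subsetI)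
    fix y assume "y \<in> P.total G"
    have "x + \<sigma> b x \<in> primary p" if "x \<in> primary r" for x b
    proof -
      have "\<sigma> b x \<in> primary ?s" using that phi_primary_iff subspace_neg[OF subs] unfolding \<sigma>_def by auto
      thus ?thesis using sub that subspace_add[OF P_subspace_imp[OF subspace_primary]] by blast
    qed
    hence "G b \<subseteq> primary p" for b unfolding G_def by blast
    thus "y \<in> primary p"
      using \<open>y \<in> P.total G\<close> subspace_add[OF P_subspace_imp[OF subspace_primary]]
      unfolding P.total_def by blast
  next
    fix x assume "x \<in> primary p"
    then obtain n where "act (p ^ n) x = 0" unfolding primary_def by blast
    hence "act (r ^ n * ?s ^ n) x = 0"
      using act_multiple_eq_0 dvd_power_same[OF pdvd] by (metis power_mult_distrib)
    then obtain y z where yz: "x = y + z" "act (r ^ n) y = 0" "act (?s ^ n) z = 0"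
      by (rule comaximal_kernel[OF comaximal_powers[OF com]])
    have y: "y \<in> primary r" and z: "z \<in> primary ?s" using yz unfolding primary_def by blast+
    obtain w where w: "z = \<phi> w" using bij_phi by (metis bij_pointE)
    have wr: "w \<in> primary r" using z phi_primary_iff unfolding w by blast
    \<comment> \<open>Solves \<open>g + h = y\<close> and \<open>g - h = w\<close>, so that
      \<open>y + \<phi> w = (g + \<phi> g) + (h - \<phi> h)\<close>; here 2 has to be
      invertible.\<close>
    define g where "g = scale (1 / 2) (y + w)"
    define h where "h = scale (1 / 2) (y - w)"
    have gh: "g \<in> primary r" "h \<in> primary r" unfolding g_def h_def
      using y wr subspace_add[OF subr] subspace_diff[OF subr] subspace_scale[OF subr] by blast+
    have half: "scale (1 / 2) x + scale (1 / 2) x = x" for x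
    proof -
      have "(1 / 2 :: 'a) + 1 / 2 = 1" using two by (simp add: field_simps)
      thus ?thesis by (metis scale_left_distrib scale_one)
    qed
    have "g + h = y" unfolding g_def h_def using half[of y] by (simp add: scale_right_distrib scale_right_diff_distrib)
    moreover have "w = g + - h" unfolding g_def h_def using half[of w]
      by (simp add: scale_right_distrib scale_right_diff_distrib)
    hence "g = h + w" by simp
    hence "z = \<phi> g - \<phi> h" unfolding w by (simp add: phi_add)
    ultimately have "x = (g + \<sigma> True g) + (h + \<sigma> (\<not> True) h)"
      unfolding yz(1) \<sigma>_def by (simp add: algebra_simps)
    thus "x \<in> P.total G" using P.totalI[of _ G, OF GI[OF gh(1)] GI[OF gh(2)]] by metis
  qed
  ultimately show ?thesis by blast
qed

theorem exchange_of_similar_uminus: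
  assumes cd: "countable_dimension scale" and tors: "\<And>x. \<exists>f. f \<noteq> 0 \<and> act f x = 0"
    and two: "(2::'a) \<noteq> 0"
  shows "exchange_property scale u"
proof -
  have "\<forall>p\<in>symmetric_primes. \<exists>G. P.grading G \<and> P.total G = primary p"
    using symmetric_primary_grading[OF cd two] by blast
  then obtain G where G: "\<And>p. p \<in> symmetric_primes \<Longrightarrow> P.grading (G p)"
    "\<And>p. p \<in> symmetric_primes \<Longrightarrow> P.total (G p) = primary p" by metis
  have "x p = 0" if J: "finite J" "J \<subseteq> symmetric_primes"
    "\<And>p. p \<in> J \<Longrightarrow> x p \<in> P.total (G p)" "sum x J = 0" "p \<in> J" for J x p
  proof (rule primary_independent[OF J(1) _ _ J(4,5)])
    show "comaximal p q" if "p \<in> J" "q \<in> J" "p \<noteq> q" for p q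
      using symmetric_primes_comaximal that J(2) by blast
    show "x p \<in> primary p" if "p \<in> J" for p using J(2,3) G(2) that by blast
  qed
  then obtain K where K: "P.grading K" "\<forall>p\<in>symmetric_primes. P.total (G p) \<subseteq> P.total K"
    using P.combine_gradings[of symmetric_primes G, OF G(1)] by blast
  have "x \<in> P.total K" for x
  proof -
    obtain f where f: "f \<noteq> 0" "act f x = 0" using tors by blast
    \<comment> \<open>Multiplication by its mirror image turns any annihilator into a symmetric
      one.\<close>
    have "act (f * negate_arg f) x = 0" using act_multiple_eq_0[OF f(2)] by simp
    moreover have "f * negate_arg f \<noteq> 0" using f(1) by simp
    moreover have "primary p \<subseteq> P.total K" if "p \<in> symmetric_primes" for p using K(2) G(2) that by blast
    ultimately show ?thesis
      using mem_if_killed_by_symmetric[OF P.subspace_total[OF K(1)] _ symmetric_mult_negate_arg] by blast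
  qed
  hence "P.total K = UNIV" by blast
  thus ?thesis using exchange_of_grading K(1) by blast
qed

end

section \<open>Torsion from local finiteness, and consequences of the exchange property\<close>

lemma act_monom: "act (monom c n) x = scale c ((u ^^ n) x)"
proof (induction n)
  case (Suc n)
  thus ?case by (simp add: monom_Suc u_scale)
qed (simp add: monom_0 u_zero)

lemma torsion_if_locally_finite:
  assumes "locally_finite_endo scale u" shows "\<exists>f. f \<noteq> 0 \<and> act f x = 0"
proof -
  obtain I c k where I: "finite I" "(\<Sum>k\<in>I. scale (c k) ((u ^^ k) x)) = 0" "k \<in> I" "c k \<noteq> 0"
    using assms unfolding locally_finite_endo_def dependent_family_def by blast
  \<comment> \<open>Indices of the family become exponents, so the polynomial is nonzero even if
    vectors of the sequence coincide.\<close>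
  define f where "f = (\<Sum>k\<in>I. monom (c k) k)"
  have "act f x = (\<Sum>k\<in>I. act (monom (c k) k) x)" unfolding f_def by (rule P.scale_sum_left)
  hence "act f x = 0" using I(2) by (simp add: act_monom)
  moreover have "coeff f k = c k" unfolding f_def using I(1,3) by (simp add: coeff_sum)
  hence "f \<noteq> 0" using I(4) by auto
  ultimately show ?thesis by blast
qed

lemma splitting_projection:
  assumes "splitting scale V1 V2"
  obtains q where "Vector_Spaces.linear scale scale q" "\<And>x. q x \<in> V1" "\<And>x. x - q x \<in> V2"
    "\<And>x. x \<in> V1 \<Longrightarrow> q x = x" "\<And>x. x \<in> V2 \<Longrightarrow> q x = 0"
proof -
  have sub: "subspace V1" "subspace V2" and all: "\<And>x. \<exists>y\<in>V1. \<exists>z\<in>V2. x = y + z" and inter: "V1 \<inter> V2 = {0}"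
    using assms unfolding splitting_def by (auto simp: set_eq_iff) metis
  have "\<forall>x. \<exists>y. y \<in> V1 \<and> x - y \<in> V2" using all by (metis add_diff_cancel_left')
  then obtain q where q: "\<And>x. q x \<in> V1" "\<And>x. x - q x \<in> V2" by metis
  have uniq: "q x = y" if y: "y \<in> V1" "x - y \<in> V2" for x y
  proof -
    have "q x - y \<in> V1" using subspace_diff[OF sub(1) q(1) y(1)] .
    moreover have "(x - y) - (x - q x) \<in> V2" using subspace_diff[OF sub(2) y(2) q(2)] .
    hence "q x - y \<in> V2" by simp
    ultimately have "q x - y = 0" using inter by blast
    thus ?thesis by simp
  qed
  have "Vector_Spaces.linear scale scale q"
  proof (unfold_locales)
    show "q (x + y) = q x + q y" for x y
    proof (rule uniq)
      show "x + y - (q x + q y) \<in> V2"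
        using subspace_add[OF sub(2) q(2)[of x] q(2)[of y]] by (simp add: algebra_simps)
    qed (use subspace_add[OF sub(1)] q in blast)
    show "q (scale c x) = scale c (q x)" for c x
    proof (rule uniq)
      show "scale c x - scale c (q x) \<in> V2"
        using subspace_scale[OF sub(2) q(2)[of x]] by (simp add: scale_right_diff_distrib)
    qed (use subspace_scale[OF sub(1)] q in blast)
  qed
  moreover have "q x = x" if "x \<in> V1" for x using uniq[OF that] subspace_0[OF sub(2)] by simp
  moreover have "q x = 0" if "x \<in> V2" for x using uniq[OF subspace_0[OF sub(1)]] that by simp
  ultimately show thesis using that q by blast
qed

text \<open>With \<open>q\<close> the projection onto \<open>V1\<close> along \<open>V2\<close>, the
  summands are \<open>u q\<close> and \<open>u (1 - q)\<close>: each kills one of the two subspaces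
  and maps the other into it.\<close>

lemma square_zero_sum_of_exchange:
  assumes "exchange_property scale u"
  shows "\<exists>a b. square_zero scale a \<and> square_zero scale b \<and> u = (\<lambda>x. a x + b x)"
proof -
  obtain V1 V2 where V: "splitting scale V1 V2" and "u ` V1 \<subseteq> V2" "u ` V2 \<subseteq> V1"
    using assms unfolding exchange_property_def by blast
  hence u1: "x \<in> V1 \<Longrightarrow> u x \<in> V2" and u2: "x \<in> V2 \<Longrightarrow> u x \<in> V1" for x by blast+
  obtain q where q: "Vector_Spaces.linear scale scale q" "\<And>x. q x \<in> V1" "\<And>x. x - q x \<in> V2"
    "\<And>x. x \<in> V1 \<Longrightarrow> q x = x" "\<And>x. x \<in> V2 \<Longrightarrow> q x = 0"
    by (rule splitting_projection[OF V]) (rule that)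
  interpret q: Vector_Spaces.linear scale scale q by (rule q(1))
  have "Vector_Spaces.linear scale scale (\<lambda>x. u (q x))"
    by unfold_locales (simp_all add: q.add q.scale u_add u_scale)
  moreover have "(\<lambda>x. u (q x)) \<circ> (\<lambda>x. u (q x)) = (\<lambda>x. 0)"
    using q(2,5) u1 u_zero by (auto simp: fun_eq_iff)
  ultimately have 1: "square_zero scale (\<lambda>x. u (q x))" unfolding square_zero_def by blast
  have "Vector_Spaces.linear scale scale (\<lambda>x. u (x - q x))"
    by unfold_locales
      (simp_all add: q.add q.scale u_add u_diff u_scale scale_right_diff_distrib algebra_simps)
  moreover have "(\<lambda>x. u (x - q x)) \<circ> (\<lambda>x. u (x - q x)) = (\<lambda>x. 0)"
    using q(3,4) u2 u_zero by (auto simp: fun_eq_iff)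
  ultimately have 2: "square_zero scale (\<lambda>x. u (x - q x))" unfolding square_zero_def by blast
  have "u = (\<lambda>x. u (q x) + u (x - q x))" by (simp add: fun_eq_iff flip: u_add)
  thus ?thesis using 1 2 by blast
qed

text \<open>The reflection that is the identity on \<open>V1\<close> and its negative on
  \<open>V2\<close> anticommutes with any endomorphism that exchanges them.\<close>

lemma similar_uminus_of_exchange:
  assumes "exchange_property scale u"
  shows "similar_endo scale scale u (\<lambda>x. - u x)"
proof -
  obtain V1 V2 where V: "splitting scale V1 V2" and "u ` V1 \<subseteq> V2" "u ` V2 \<subseteq> V1"
    using assms unfolding exchange_property_def by blast
  hence u1: "x \<in> V1 \<Longrightarrow> u x \<in> V2" and u2: "x \<in> V2 \<Longrightarrow> u x \<in> V1" for x by blast+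
  obtain q where q: "Vector_Spaces.linear scale scale q" "\<And>x. q x \<in> V1" "\<And>x. x - q x \<in> V2"
    "\<And>x. x \<in> V1 \<Longrightarrow> q x = x" "\<And>x. x \<in> V2 \<Longrightarrow> q x = 0"
    by (rule splitting_projection[OF V]) (rule that)
  interpret q: Vector_Spaces.linear scale scale q by (rule q(1))
  define \<phi> where "\<phi> x = q x - (x - q x)" for x
  have lin: "Vector_Spaces.linear scale scale \<phi>"
    unfolding \<phi>_def by unfold_locales (simp_all add: q.add q.scale scale_right_diff_distrib algebra_simps)
  have "\<phi> (\<phi> x) = x" for x unfolding \<phi>_def using q(2,4) by (simp add: q.diff)
  hence inv: "\<phi> \<circ> \<phi> = id" by (simp add: fun_eq_iff)
  hence bij: "bij \<phi>" by (rule o_bij[OF inv])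
  have inv_eq: "inv \<phi> = \<phi>" by (rule inv_unique_comp[OF inv inv])
  have "\<phi> (u (\<phi> x)) = - u x" for x
  proof -
    have "q (u x) = u (x - q x)" for x
    proof -
      have "u x = u (q x) + u (x - q x)" by (simp flip: u_add)
      hence "q (u x) = q (u (q x)) + q (u (x - q x))" by (metis q.add)
      thus ?thesis using q(2,3,4,5) u1 u2 by simp
    qed
    hence "\<phi> (u x) = - u (\<phi> x)" for x unfolding \<phi>_def by (simp add: u_diff)
    thus ?thesis using \<open>\<And>x. \<phi> (\<phi> x) = x\<close> by simp
  qed
  hence "(\<lambda>x. - u x) = \<phi> \<circ> u \<circ> inv \<phi>" unfolding inv_eq by (simp add: fun_eq_iff)
  thus ?thesis unfolding similar_endo_def using lin bij by blast
qed

end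

theorem theorem1p4:
  fixes scale :: "'a::field \<Rightarrow> 'v::ab_group_add \<Rightarrow> 'v"
    and u :: "'v \<Rightarrow> 'v"
  assumes "vector_space scale"
    and "countable_dimension scale"
    and "locally_finite_endo scale u"
  shows "((\<exists>a b. square_zero scale a \<and> square_zero scale b \<and> u = (\<lambda>x. a x + b x))
            \<longleftrightarrow> exchange_property scale u)
       \<and> (CHAR('a) \<noteq> 2 \<longrightarrow>
            (exchange_property scale u \<longleftrightarrow> similar_endo scale scale u (\<lambda>x. - u x)))"
proof -
  interpret poly_module scale u
    using assms(1,3) unfolding locally_finite_endo_def
    by (intro poly_module.intro poly_module_axioms.intro) auto
  note tors = torsion_if_locally_finite[OF assms(3)]
  have "exchange_property scale u"
    if char: "CHAR('a) \<noteq> 2" and sim: "similar_endo scale scale u (\<lambda>x. - u x)"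
  proof -
    obtain \<phi> where \<phi>: "Vector_Spaces.linear scale scale \<phi>" "bij \<phi>" "(\<lambda>x. - u x) = \<phi> \<circ> u \<circ> inv \<phi>"
      using sim unfolding similar_endo_def by blast
    have "\<phi> (u x) = - u (\<phi> x)" for x
      using fun_cong[OF \<phi>(3), of "\<phi> x"] \<phi>(2) by (simp add: bij_is_inj)
    moreover have "(2::'a) \<noteq> 0"
    proof
      assume "(2::'a) = 0"
      hence "of_nat 2 = (0::'a)" by simp
      hence "CHAR('a) dvd 2" unfolding of_nat_eq_0_iff_char_dvd .
      hence "CHAR('a) \<le> 2" "CHAR('a) \<noteq> 0" using dvd_imp_le by (auto intro!: Nat.gr0I)
      thus False using char CHAR_not_1[where 'a='a] by linarith
    qed
    ultimately show ?thesis using exchange_of_similar_uminus[OF \<phi>(1,2) _ assms(2) tors] by blast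
  qed
  thus ?thesis
    using exchange_of_square_zero_sum[OF assms(2) tors] square_zero_sum_of_exchange
      similar_uminus_of_exchange by blast
qed

end
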